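(* Let $K:\mathbb{R}\to\mathbb{R}$ be a continuous function that is not a polynomial, and let $$\mathcal{S}=\mathrm{span}\left\{\, x\mapsto K\!\left(\frac{x-c}{\sigma}\right) \;:\; c,\sigma\in\mathbb{R},\ \sigma\neq 0\right\}$$ (finite linear combinations of shifted and rescaled copies of $K$, viewed as functions $\mathbb{R}\to\mathbb{R}$). Let $d\ge 1$ be an integer. Then for every continuous $f:[0,1]^d\to\mathbb{R}$ and every $\varepsilon>0$ there exist functions $\widehat{\Phi}^{(q)}\in\mathcal{S}$ for $1\le q\le 2d+1$ and $\widehat{\phi}^{(pq)}\in\mathcal{S}$ for $1\le p\le d$, $1\le q\le 2d+1$, such that the function $$g(x_1,\dots,x_d)=\sum_{q=1}^{2d+1}\widehat{\Phi}^{(q)}\!\left(\sum_{p=1}^{d}\widehat{\phi}^{(pq)}(x_p)\right)$$ satisfies $$\sup_{(x_1,\dots,x_d)\in[0,1]^d}\bigl|f(x_1,\dots,x_d)-g(x_1,\dots,x_d)\bigr|<\varepsilon .$$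
   Context: A function of the displayed form $g$ (a sum over $q$ of outer univariate functions from $\mathcal{S}$ applied to sums over $p$ of inner univariate functions from $\mathcal{S}$ of single coordinates) is called a non-polynomial KAN (NP-KAN) network with kernel $K$. *)

theory Defs
  imports "HOL-Analysis.Analysis" "HOL-Computational_Algebra.Polynomial"
begin

definition kernel_span :: "(real \<Rightarrow> real) \<Rightarrow> (real \<Rightarrow> real) set" where
  "kernel_span K = {h. \<exists>(n::nat) (a::nat \<Rightarrow> real) (c::nat \<Rightarrow> real) (s::nat \<Rightarrow> real).
      (\<forall>i<n. s i \<noteq> 0) \<and> h = (\<lambda>x. \<Sum>i<n. a i * K ((x - c i) / s i))}"

definition is_polynomial_fun :: "(real \<Rightarrow> real) \<Rightarrow> bool" where
  "is_polynomial_fun K \<longleftrightarrow> (\<exists>p :: real poly. \<forall>x. K x = poly p x)"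

end

theory Submission
  imports Defs
begin

text \<open>
  Density of the span of \<open>K\<close>: the \<open>k\<close>-fold box average \<open>F\<close> of \<open>K\<close> over intervals of length \<open>\<eta>\<close> is
  \<open>k\<close> times differentiable, and by Riemann sums all \<open>x \<mapsto> F (w * x + b)\<close> lie in the locally uniform
  closure of the span. Differentiating \<open>k\<close> times in \<open>w\<close> at \<open>w = 0\<close> puts \<open>x ^ k\<close> times the \<open>k\<close>-th
  derivative of \<open>F\<close> at \<open>b\<close> into the closure. If that derivative vanishes for all \<open>b\<close> and \<open>\<eta>\<close>, every
  such \<open>F\<close> is a polynomial of degree less than \<open>k\<close>, hence so is the limit \<open>K\<close> as \<open>\<eta>\<close> tends to \<open>0\<close>.
  Otherwise all monomials are in the closure and Weierstrass applies.

  Superposition: as only approximation is needed, Kolmogorov's theorem reduces to a contraction. An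
  arbitrarily small change of the inner functions allows new outer functions to reduce a residual by
  a fixed factor, while uniform continuity keeps the effect of the change on the old outer functions
  negligible. No single choice of inner functions has to serve all residuals.
\<close>

section \<open>Density of the span of a non-polynomial kernel\<close>

lemma sum_lessThan_add:
  fixes f :: "nat \<Rightarrow> 'a::comm_monoid_add"
  shows "(\<Sum>i<n + m. f i) = (\<Sum>i<n. f i) + (\<Sum>i<m. f (n + i))"
  by (induction m) (auto simp: algebra_simps)

lemma kernel_span_zero: "(\<lambda>x. 0) \<in> kernel_span K"
  unfolding kernel_span_def by (auto intro!: exI[of _ "0::nat"])

lemma kernel_span_add:
  assumes "f \<in> kernel_span K" "g \<in> kernel_span K"
  shows "(\<lambda>x. f x + g x) \<in> kernel_span K"
proof -
  obtain n :: nat and a c s where f: "\<forall>i<n. s i \<noteq> 0" "f = (\<lambda>x. \<Sum>i<n. a i * K ((x - c i) / s i))"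
    using assms(1) unfolding kernel_span_def by blast
  obtain m :: nat and a' c' s' where g: "\<forall>i<m. s' i \<noteq> 0" "g = (\<lambda>x. \<Sum>i<m. a' i * K ((x - c' i) / s' i))"
    using assms(2) unfolding kernel_span_def by blast
  define glue :: "(nat \<Rightarrow> real) \<Rightarrow> (nat \<Rightarrow> real) \<Rightarrow> nat \<Rightarrow> real"
    where "glue u v i = (if i < n then u i else v (i - n))" for u v i
  have "\<forall>i<n + m. glue s s' i \<noteq> 0"
    using f(1) g(1) by (auto simp: glue_def)
  moreover have "(\<lambda>x. f x + g x) =
      (\<lambda>x. \<Sum>i<n + m. glue a a' i * K ((x - glue c c' i) / glue s s' i))"
    by (rule ext) (simp add: f(2) g(2) sum_lessThan_add glue_def)
  ultimately show ?thesis
    unfolding kernel_span_def by blast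
qed

lemma kernel_span_scale:
  assumes "f \<in> kernel_span K"
  shows "(\<lambda>x. r * f x) \<in> kernel_span K"
proof -
  obtain n :: nat and a c s where f: "\<forall>i<n. s i \<noteq> 0" "f = (\<lambda>x. \<Sum>i<n. a i * K ((x - c i) / s i))"
    using assms unfolding kernel_span_def by blast
  have "(\<lambda>x. r * f x) = (\<lambda>x. \<Sum>i<n. (r * a i) * K ((x - c i) / s i))"
    by (rule ext) (simp add: f(2) sum_distrib_left mult.assoc)
  with f(1) show ?thesis
    unfolding kernel_span_def mem_Collect_eq
    by (intro exI[of _ n] exI[of _ "\<lambda>i. r * a i"] exI[of _ c] exI[of _ s] conjI)
qed

lemma kernel_span_affine:
  assumes "w \<noteq> 0"
  shows "(\<lambda>x. K (w * x + b)) \<in> kernel_span K"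
proof -
  have "(\<lambda>x. K (w * x + b)) = (\<lambda>x. \<Sum>i<(1::nat). 1 * K ((x - (- b / w)) / (1 / w)))"
    by (rule ext) (use assms in \<open>simp add: distrib_left mult.commute\<close>)
  with assms show ?thesis
    unfolding kernel_span_def mem_Collect_eq
    by (intro exI[of _ "1::nat"] exI[of _ "\<lambda>i. 1"] exI[of _ "\<lambda>i. - b / w"] exI[of _ "\<lambda>i. 1 / w"] conjI)
      simp_all
qed

lemma continuous_on_kernel_span:
  assumes "continuous_on UNIV K" "f \<in> kernel_span K"
  shows "continuous_on A f"
proof -
  obtain n :: nat and a c s where f: "\<forall>i<n. s i \<noteq> 0" "f = (\<lambda>x. \<Sum>i<n. a i * K ((x - c i) / s i))"
    using assms(2) unfolding kernel_span_def by blast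
  show ?thesis
    unfolding f(2) by (intro continuous_intros continuous_on_compose2[OF assms(1)]) (use f(1) in auto)
qed

section \<open>The closure of the span under locally uniform limits\<close>

definition kernel_closure :: "(real \<Rightarrow> real) \<Rightarrow> (real \<Rightarrow> real) set" where
  "kernel_closure K = {g. \<forall>R e. 0 < e \<longrightarrow> (\<exists>s\<in>kernel_span K. \<forall>x. \<bar>x\<bar> \<le> R \<longrightarrow> \<bar>g x - s x\<bar> < e)}"

lemma kernel_closureD:
  assumes "g \<in> kernel_closure K" "0 < e"
  obtains s where "s \<in> kernel_span K" "\<And>x. \<bar>x\<bar> \<le> R \<Longrightarrow> \<bar>g x - s x\<bar> < e"
  using assms unfolding kernel_closure_def by blast

text \<open>Idempotence of the closure, by halving the error. Afterwards Riemann sums and difference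
  quotients only need terms from the closure, not from the span.\<close>

lemma kernel_closure_limit:
  assumes "\<And>R e. 0 < e \<Longrightarrow> \<exists>s\<in>kernel_closure K. \<forall>x. \<bar>x\<bar> \<le> R \<longrightarrow> \<bar>g x - s x\<bar> < e"
  shows "g \<in> kernel_closure K"
  unfolding kernel_closure_def mem_Collect_eq
proof (intro allI impI)
  fix R e :: real
  assume e: "0 < e"
  obtain s where s: "s \<in> kernel_closure K" "\<And>x. \<bar>x\<bar> \<le> R \<Longrightarrow> \<bar>g x - s x\<bar> < e / 2"
    using assms[of "e / 2" R] e by auto
  obtain t where t: "t \<in> kernel_span K" "\<And>x. \<bar>x\<bar> \<le> R \<Longrightarrow> \<bar>s x - t x\<bar> < e / 2"
    using kernel_closureD[OF s(1), of "e / 2" R] e by auto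
  have "\<bar>g x - t x\<bar> < e" if "\<bar>x\<bar> \<le> R" for x
    using s(2)[OF that] t(2)[OF that] by linarith
  with t(1) show "\<exists>s\<in>kernel_span K. \<forall>x. \<bar>x\<bar> \<le> R \<longrightarrow> \<bar>g x - s x\<bar> < e"
    by blast
qed

lemma kernel_closure_add:
  assumes "f \<in> kernel_closure K" "g \<in> kernel_closure K"
  shows "(\<lambda>x. f x + g x) \<in> kernel_closure K"
  unfolding kernel_closure_def mem_Collect_eq
proof (intro allI impI)
  fix R e :: real
  assume e: "0 < e"
  obtain s where s: "s \<in> kernel_span K" "\<And>x. \<bar>x\<bar> \<le> R \<Longrightarrow> \<bar>f x - s x\<bar> < e / 2"
    using kernel_closureD[OF assms(1), of "e / 2" R] e by auto
  obtain t where t: "t \<in> kernel_span K" "\<And>x. \<bar>x\<bar> \<le> R \<Longrightarrow> \<bar>g x - t x\<bar> < e / 2"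
    using kernel_closureD[OF assms(2), of "e / 2" R] e by auto
  have "\<bar>f x + g x - (s x + t x)\<bar> < e" if "\<bar>x\<bar> \<le> R" for x
    using s(2)[OF that] t(2)[OF that] by linarith
  with kernel_span_add[OF s(1) t(1)]
  show "\<exists>s\<in>kernel_span K. \<forall>x. \<bar>x\<bar> \<le> R \<longrightarrow> \<bar>f x + g x - s x\<bar> < e"
    by (intro bexI[of _ "\<lambda>x. s x + t x"]) auto
qed

lemma kernel_closure_scale:
  assumes "f \<in> kernel_closure K"
  shows "(\<lambda>x. r * f x) \<in> kernel_closure K"
  unfolding kernel_closure_def mem_Collect_eq
proof (intro allI impI)
  fix R e :: real
  assume e: "0 < e"
  \<comment> \<open>The summand 1 covers \<open>r = 0\<close>.\<close>
  have pos: "0 < e / (\<bar>r\<bar> + 1)"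
    using e by (simp add: add_nonneg_pos)
  obtain s where s: "s \<in> kernel_span K" "\<And>x. \<bar>x\<bar> \<le> R \<Longrightarrow> \<bar>f x - s x\<bar> < e / (\<bar>r\<bar> + 1)"
    using kernel_closureD[OF assms pos, of R] by auto
  have "\<bar>r * f x - r * s x\<bar> < e" if "\<bar>x\<bar> \<le> R" for x
  proof -
    have "\<bar>r * f x - r * s x\<bar> = \<bar>r\<bar> * \<bar>f x - s x\<bar>"
      by (simp add: right_diff_distrib[symmetric] abs_mult)
    also have "\<dots> \<le> \<bar>r\<bar> * (e / (\<bar>r\<bar> + 1))"
      using s(2)[OF that] by (intro mult_left_mono) auto
    also have "\<dots> < e"
      using e by (simp add: field_simps add_nonneg_pos)
    finally show ?thesis .
  qed
  with kernel_span_scale[OF s(1)]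
  show "\<exists>s\<in>kernel_span K. \<forall>x. \<bar>x\<bar> \<le> R \<longrightarrow> \<bar>r * f x - s x\<bar> < e"
    by (intro bexI[of _ "\<lambda>x. r * s x"]) auto
qed

lemma kernel_span_subset_closure: "f \<in> kernel_span K \<Longrightarrow> f \<in> kernel_closure K"
  unfolding kernel_closure_def by force

lemma kernel_closure_sum:
  assumes "finite I" "\<And>i. i \<in> I \<Longrightarrow> f i \<in> kernel_closure K"
  shows "(\<lambda>x. \<Sum>i\<in>I. f i x) \<in> kernel_closure K"
  using assms
  by (induction I)
    (auto intro: kernel_closure_add kernel_span_subset_closure[OF kernel_span_zero])

text \<open>Uniform continuity on a compact interval enlarged by 1. Only \<open>x\<close> is
  confined to the bounded range; cutting the modulus at 1 keeps \<open>y\<close> in the enlarged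
  interval.\<close>

lemma continuous_modulus_on_bounded:
  fixes f :: "real \<Rightarrow> real"
  assumes "continuous_on UNIV f" "0 < e"
  obtains d where "0 < d"
    "\<And>x y. \<bar>x\<bar> \<le> R \<Longrightarrow> \<bar>y - x\<bar> < d \<Longrightarrow> \<bar>f y - f x\<bar> < e"
proof -
  have "uniformly_continuous_on {- (\<bar>R\<bar> + 1)..\<bar>R\<bar> + 1} f"
    using assms(1) by (intro compact_uniformly_continuous) (auto intro: continuous_on_subset)
  then obtain d where d: "0 < d"
    "\<And>x y. x \<in> {- (\<bar>R\<bar> + 1)..\<bar>R\<bar> + 1} \<Longrightarrow> y \<in> {- (\<bar>R\<bar> + 1)..\<bar>R\<bar> + 1} \<Longrightarrow> dist y x < d \<Longrightarrow> dist (f y) (f x) < e"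
    unfolding uniformly_continuous_on_def using assms(2) by meson
  have "\<bar>f y - f x\<bar> < e" if "\<bar>x\<bar> \<le> R" "\<bar>y - x\<bar> < min d 1" for x y
  proof -
    have "x \<in> {- (\<bar>R\<bar> + 1)..\<bar>R\<bar> + 1}" "y \<in> {- (\<bar>R\<bar> + 1)..\<bar>R\<bar> + 1}"
      using that unfolding atLeastAtMost_iff by linarith+
    from d(2)[OF this] that show ?thesis
      by (simp add: dist_real_def)
  qed
  with d(1) show ?thesis
    by (intro that[of "min d 1"]) auto
qed

text \<open>For \<open>w = 0\<close> the function is a constant, which need not lie in the span
  because scales are nonzero; it is the limit of \<open>K (v * x + b)\<close> as \<open>v\<close>
  tends to 0. Differentiation in \<open>w\<close> at 0 relies on this case.\<close>

lemma kernel_closure_affine: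
  assumes "continuous_on UNIV K"
  shows "(\<lambda>x. K (w * x + b)) \<in> kernel_closure K"
proof (cases "w = 0")
  case False
  then show ?thesis
    by (intro kernel_span_subset_closure kernel_span_affine)
next
  case True
  show ?thesis
    unfolding kernel_closure_def mem_Collect_eq
  proof (intro allI impI)
    fix R e :: real
    assume "0 < e"
    then obtain d where d: "0 < d" "\<And>y. \<bar>y - b\<bar> < d \<Longrightarrow> \<bar>K y - K b\<bar> < e"
      using continuous_modulus_on_bounded[OF assms, of e "\<bar>b\<bar>"] by (metis order_refl)
    define v where "v = d / (\<bar>R\<bar> + 1)"
    have v: "0 < v"
      using d(1) by (simp add: v_def add_nonneg_pos)
    have "\<bar>K b - K (v * x + b)\<bar> < e" if "\<bar>x\<bar> \<le> R" for x
    proof -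
      have "\<bar>v * x\<bar> \<le> v * \<bar>R\<bar>"
        using that v by (auto simp: abs_mult)
      also have "\<dots> < d"
        using d(1) by (simp add: v_def field_simps add_nonneg_pos)
      finally show ?thesis
        using d(2)[of "v * x + b"] by simp
    qed
    then show "\<exists>s\<in>kernel_span K. \<forall>x. \<bar>x\<bar> \<le> R \<longrightarrow> \<bar>K (w * x + b) - s x\<bar> < e"
      using v True by (intro bexI[of _ "\<lambda>x. K (v * x + b)"] kernel_span_affine) auto
  qed
qed

section \<open>Box averages and their derivatives\<close>

text \<open>The mean of \<open>f\<close> over \<open>[x, x + \<eta>]\<close>, for continuous \<open>f\<close>; otherwise an antiderivative may not exist
  and the value is unspecified.\<close>

definition box_average :: "real \<Rightarrow> (real \<Rightarrow> real) \<Rightarrow> real \<Rightarrow> real" where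
  "box_average \<eta> f x =
     (let P = (SOME P. \<forall>x. (P has_real_derivative f x) (at x)) in (P (x + \<eta>) - P x) / \<eta>)"

lemma box_average_antiderivative:
  assumes "continuous_on UNIV f"
  obtains P where "\<And>x. (P has_real_derivative f x) (at x)"
    "\<And>\<eta> x. box_average \<eta> f x = (P (x + \<eta>) - P x) / \<eta>"
proof -
  have "\<exists>P. \<forall>x. - \<infinity> < ereal x \<longrightarrow> ereal x < \<infinity> \<longrightarrow> (P has_vector_derivative f x) (at x)"
    using assms by (intro einterval_antiderivative) (auto simp: continuous_on_eq_continuous_at)
  then have "\<exists>P. \<forall>x. (P has_real_derivative f x) (at x)"
    by (simp add: has_real_derivative_iff_has_vector_derivative)
  from someI_ex[OF this] show ?thesis
    by (intro that[of "SOME P. \<forall>x. (P has_real_derivative f x) (at x)"]) (auto simp: box_average_def Let_def)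
qed

definition difference_quotient :: "real \<Rightarrow> (real \<Rightarrow> real) \<Rightarrow> real \<Rightarrow> real" where
  "difference_quotient \<eta> f x = (f (x + \<eta>) - f x) / \<eta>"

lemma difference_quotient_deriv:
  assumes "\<And>x. (f has_real_derivative f' x) (at x)"
  shows "(difference_quotient \<eta> f has_real_derivative difference_quotient \<eta> f' x) (at x)"
  unfolding difference_quotient_def[abs_def]
  by (intro DERIV_cdivide DERIV_diff assms) (use assms[of "x + \<eta>"] in \<open>simp add: DERIV_shift\<close>)

lemma difference_quotient_funpow_deriv:
  assumes "\<And>x. (f has_real_derivative f' x) (at x)"
  shows "((difference_quotient \<eta> ^^ i) f has_real_derivative (difference_quotient \<eta> ^^ i) f' x) (at x)"
  by (induction i arbitrary: x) (auto intro: assms difference_quotient_deriv)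

lemma continuous_on_difference_quotient_funpow:
  assumes "continuous_on UNIV f"
  shows "continuous_on UNIV ((difference_quotient \<eta> ^^ i) f)"
proof (induction i)
  case (Suc i)
  \<comment> \<open>Multiplying by \<open>inverse \<eta>\<close> avoids a case distinction on \<eta>
    = 0.\<close>
  have "continuous_on UNIV (\<lambda>x. ((difference_quotient \<eta> ^^ i) f (x + \<eta>) - (difference_quotient \<eta> ^^ i) f x) * inverse \<eta>)"
    by (intro continuous_intros Suc.IH continuous_on_compose2[OF Suc.IH]) auto
  then show ?case
    unfolding funpow.simps o_def
    by (subst difference_quotient_def[abs_def]) (simp add: divide_inverse)
qed (use assms in auto)

text \<open>Fundamental theorem of calculus: the average is a difference quotient of an
  antiderivative, and difference quotients commute with differentiation.\<close>

lemma box_average_deriv: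
  assumes "continuous_on UNIV f"
  shows "(box_average \<eta> f has_real_derivative difference_quotient \<eta> f x) (at x)"
proof -
  obtain P where P: "\<And>x. (P has_real_derivative f x) (at x)"
    "\<And>\<eta> x. box_average \<eta> f x = (P (x + \<eta>) - P x) / \<eta>"
    using box_average_antiderivative[OF assms] by metis
  have "box_average \<eta> f = difference_quotient \<eta> P"
    by (rule ext) (simp add: P(2) difference_quotient_def)
  with difference_quotient_deriv[OF P(1)] show ?thesis
    by simp
qed

lemma continuous_on_box_average:
  assumes "continuous_on UNIV f"
  shows "continuous_on UNIV (box_average \<eta> f)"
  using box_average_deriv[OF assms] by (meson DERIV_continuous continuous_at_imp_continuous_on)

lemma continuous_on_box_average_funpow:
  assumes "continuous_on UNIV f"
  shows "continuous_on UNIV ((box_average \<eta> ^^ i) f)"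
  by (induction i) (auto intro: assms continuous_on_box_average)

text \<open>Mean value theorem applied to the antiderivative.\<close>

lemma box_average_mean_value:
  assumes "continuous_on UNIV f" "0 < \<eta>"
  obtains \<xi> where "x < \<xi>" "\<xi> < x + \<eta>" "box_average \<eta> f x = f \<xi>"
proof -
  obtain P where P: "\<And>x. (P has_real_derivative f x) (at x)"
    "\<And>\<eta> x. box_average \<eta> f x = (P (x + \<eta>) - P x) / \<eta>"
    using box_average_antiderivative[OF assms(1)] by metis
  obtain \<xi> where "x < \<xi>" "\<xi> < x + \<eta>" "P (x + \<eta>) - P x = (x + \<eta> - x) * f \<xi>"
    using MVT2[of x "x + \<eta>" P f] P(1) assms(2) by auto
  with assms(2) show ?thesis
    by (intro that[of \<xi>]) (auto simp: P(2))
qed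

text \<open>Additivity of the integral: the increments of the antiderivative over the
  \<open>n\<close> pieces telescope.\<close>

lemma box_average_subdivide:
  assumes "continuous_on UNIV f" "0 < n"
  shows "box_average \<eta> f x = (1 / real n) * (\<Sum>i<n. box_average (\<eta> / real n) f (x + real i * (\<eta> / real n)))"
proof -
  obtain P where P: "\<And>\<eta> x. box_average \<eta> f x = (P (x + \<eta>) - P x) / \<eta>"
    using box_average_antiderivative[OF assms(1)] by metis
  have "(\<Sum>i<n. P (x + real i * (\<eta> / real n) + \<eta> / real n) - P (x + real i * (\<eta> / real n)))
      = (\<Sum>i<n. P (x + real (Suc i) * (\<eta> / real n)) - P (x + real i * (\<eta> / real n)))"
    by (simp add: algebra_simps add_divide_distrib)
  also have "\<dots> = P (x + real n * (\<eta> / real n)) - P (x + real 0 * (\<eta> / real n))"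
    by (rule sum_lessThan_telescope[of "\<lambda>i. P (x + real i * (\<eta> / real n))"])
  finally have "(\<Sum>i<n. P (x + real i * (\<eta> / real n) + \<eta> / real n) - P (x + real i * (\<eta> / real n))) = P (x + \<eta>) - P x"
    using assms(2) by simp
  then show ?thesis
    using assms(2) unfolding P sum_divide_distrib[symmetric] by simp
qed

text \<open>The average at \<open>x\<close> is attained at some \<xi> within \<eta> to its right, so
  each further average extends the window of relevant values by \<eta>.\<close>

lemma box_average_funpow_near:
  assumes "continuous_on UNIV f" "0 < \<eta>" "\<And>y. x \<le> y \<Longrightarrow> y \<le> x + real j * \<eta> \<Longrightarrow> \<bar>f y - c\<bar> \<le> e"
  shows "\<bar>(box_average \<eta> ^^ j) f x - c\<bar> \<le> e"
  using assms(3)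
proof (induction j arbitrary: x)
  case (Suc j)
  obtain \<xi> where \<xi>: "x < \<xi>" "\<xi> < x + \<eta>" "box_average \<eta> ((box_average \<eta> ^^ j) f) x = (box_average \<eta> ^^ j) f \<xi>"
    using box_average_mean_value[OF continuous_on_box_average_funpow[OF assms(1)] assms(2)] by metis
  have "\<bar>(box_average \<eta> ^^ j) f \<xi> - c\<bar> \<le> e"
    using \<xi>(1,2) by (intro Suc.IH Suc.prems) (auto simp: algebra_simps)
  then show ?case
    using \<xi>(3) by simp
qed auto

section \<open>Averages and parameter derivatives in the closure\<close>

text \<open>Left Riemann sums of mesh \<open>h\<close> replace each small average by the value of
  \<open>f\<close> at its left end. They use shifted offsets, so the hypothesis covers all
  \<open>b\<close>.\<close>

lemma kernel_closure_box_average: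
  assumes f: "continuous_on UNIV f" and "0 < \<eta>"
    and cl: "\<And>w b. (\<lambda>x. f (w * x + b)) \<in> kernel_closure K"
  shows "(\<lambda>x. box_average \<eta> f (w * x + b)) \<in> kernel_closure K"
proof (rule kernel_closure_limit)
  fix R e :: real
  assume "0 < e"
  \<comment> \<open>Bounds every sample point \<open>w * x + b + real i * h\<close>, since
    \<open>real i * h\<close> is at most \<eta>.\<close>
  define R' where "R' = \<bar>w\<bar> * \<bar>R\<bar> + \<bar>b\<bar> + \<eta>"
  obtain d where d: "0 < d" "\<And>x y. \<bar>x\<bar> \<le> R' \<Longrightarrow> \<bar>y - x\<bar> < d \<Longrightarrow> \<bar>f y - f x\<bar> < e"
    using continuous_modulus_on_bounded[OF f \<open>0 < e\<close>, of R'] by blast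
  \<comment> \<open>More than \<open>\<eta> / d\<close> pieces make the mesh smaller than the
    modulus \<open>d\<close>.\<close>
  obtain n :: nat where n: "\<eta> / d < real n" "0 < n"
    by (metis reals_Archimedean2 gr0I less_trans of_nat_0 divide_pos_pos[OF \<open>0 < \<eta>\<close> \<open>0 < d\<close>] not_less_iff_gr_or_eq)
  define h where "h = \<eta> / real n"
  have h: "0 < h" "h < d"
    using n \<open>0 < \<eta>\<close> \<open>0 < d\<close> by (auto simp: h_def field_simps)
  define s where "s = (\<lambda>x. (1 / real n) * (\<Sum>i<n. f (w * x + (b + real i * h))))"
  have s: "s \<in> kernel_closure K"
    unfolding s_def by (intro kernel_closure_scale kernel_closure_sum cl) auto
  have "\<bar>box_average \<eta> f (w * x + b) - s x\<bar> < e" if "\<bar>x\<bar> \<le> R" for x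
  proof -
    let ?u = "\<lambda>i. w * x + b + real i * h"
    have term_bound: "\<bar>box_average h f (?u i) - f (?u i)\<bar> < e" if "i < n" for i
    proof -
      obtain \<xi> where \<xi>: "?u i < \<xi>" "\<xi> < ?u i + h" "box_average h f (?u i) = f \<xi>"
        using box_average_mean_value[OF f h(1)] by metis
      have "\<bar>w * x\<bar> \<le> \<bar>w\<bar> * \<bar>R\<bar>"
        using \<open>\<bar>x\<bar> \<le> R\<close> by (auto simp: abs_mult intro!: mult_left_mono)
      moreover have "real i * h \<le> real n * h" "0 \<le> real i * h"
        using that h(1) by (auto intro!: mult_right_mono)
      moreover have "real n * h = \<eta>"
        using n(2) by (simp add: h_def)
      ultimately have "\<bar>?u i\<bar> \<le> R'"
        unfolding R'_def by linarith
      then show ?thesis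
        using d(2)[of "?u i" \<xi>] \<xi> h(2) by auto
    qed
    have "\<bar>box_average \<eta> f (w * x + b) - s x\<bar> =
        (1 / real n) * \<bar>\<Sum>i<n. box_average h f (?u i) - f (?u i)\<bar>"
      unfolding s_def box_average_subdivide[OF f n(2), of \<eta>] h_def[symmetric]
      by (simp add: right_diff_distrib[symmetric] sum_subtractf[symmetric] abs_mult add.assoc diff_divide_distrib[symmetric])
    also have "\<bar>\<Sum>i<n. box_average h f (?u i) - f (?u i)\<bar> < real n * e"
    proof -
      have "\<bar>\<Sum>i<n. box_average h f (?u i) - f (?u i)\<bar> \<le> (\<Sum>i<n. \<bar>box_average h f (?u i) - f (?u i)\<bar>)"
        by (rule sum_abs)
      also have "\<dots> < (\<Sum>i<n. e)"
        using n(2) term_bound by (intro sum_strict_mono) auto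
      finally show ?thesis by simp
    qed
    finally show ?thesis
      using n(2) by (simp add: field_simps)
  qed
  with s show "\<exists>s\<in>kernel_closure K. \<forall>x. \<bar>x\<bar> \<le> R \<longrightarrow> \<bar>box_average \<eta> f (w * x + b) - s x\<bar> < e"
    by blast
qed

lemma kernel_closure_box_average_funpow:
  assumes "continuous_on UNIV K" "0 < \<eta>"
  shows "(\<lambda>x. (box_average \<eta> ^^ j) K (w * x + b)) \<in> kernel_closure K"
  by (induction j arbitrary: w b)
    (auto intro: assms kernel_closure_affine kernel_closure_box_average continuous_on_box_average_funpow)

text \<open>The limit function is the derivative of \<open>x ^ i * G (w * x + b)\<close> with
  respect to \<open>w\<close>. By the mean value theorem the difference quotient in \<open>w\<close>
  equals \<open>x ^ Suc i * G' \<xi>\<close> with \<xi> close to \<open>w * x + b\<close>, uniformly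
  for bounded \<open>x\<close>.\<close>

lemma kernel_closure_deriv:
  assumes G: "\<And>x. (G has_real_derivative G' x) (at x)" and G': "continuous_on UNIV G'"
    and cl: "\<And>w b. (\<lambda>x. x ^ i * G (w * x + b)) \<in> kernel_closure K"
  shows "(\<lambda>x. x ^ Suc i * G' (w * x + b)) \<in> kernel_closure K"
proof (rule kernel_closure_limit)
  fix R e :: real
  assume "0 < e"
  define r where "r = \<bar>R\<bar> + 1"
  define R' where "R' = \<bar>w\<bar> * r + \<bar>b\<bar>"
  have r: "0 < r" by (simp add: r_def)
  have "0 < e / r ^ Suc i"
    using \<open>0 < e\<close> r by simp
  then obtain d where d: "0 < d" "\<And>x y. \<bar>x\<bar> \<le> R' \<Longrightarrow> \<bar>y - x\<bar> < d \<Longrightarrow> \<bar>G' y - G' x\<bar> < e / r ^ Suc i"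
    using continuous_modulus_on_bounded[OF G'] by metis
  \<comment> \<open>The step in \<open>w\<close> displaces the argument by at most
    \<open>h * r = d / 2\<close>, inside the modulus.\<close>
  define h where "h = d / (2 * r)"
  have h: "0 < h" "h * r < d"
    using d(1) r by (auto simp: h_def)
  define s where "s = (\<lambda>x. (1 / h) * (x ^ i * G ((w + h) * x + b) + (- 1) * (x ^ i * G (w * x + b))))"
  have s: "s \<in> kernel_closure K"
    unfolding s_def by (intro kernel_closure_scale kernel_closure_add cl)
  have "\<bar>x ^ Suc i * G' (w * x + b) - s x\<bar> < e" if x: "\<bar>x\<bar> \<le> R" for x
  proof -
    let ?u = "w * x + b"
    have xr: "\<bar>x\<bar> \<le> r" using x by (simp add: r_def)
    obtain \<xi> where \<xi>: "\<bar>\<xi> - ?u\<bar> \<le> \<bar>h * x\<bar>" "G (?u + h * x) - G ?u = h * x * G' \<xi>"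
    \<comment> \<open>The displacement \<open>h * x\<close> takes the sign of \<open>x\<close>,
      while the mean value theorem needs ordered endpoints.\<close>
    proof (cases "h * x" "0::real" rule: linorder_cases)
      case less
      then obtain z where "?u + h * x < z" "z < ?u" "G ?u - G (?u + h * x) = (?u - (?u + h * x)) * G' z"
        using MVT2[of "?u + h * x" ?u G G'] G by auto
      with less show ?thesis by (intro that[of z]) (auto simp: algebra_simps)
    next
      case equal
      then show ?thesis by (intro that[of ?u]) auto
    next
      case greater
      then obtain z where "?u < z" "z < ?u + h * x" "G (?u + h * x) - G ?u = (?u + h * x - ?u) * G' z"
        using MVT2[of ?u "?u + h * x" G G'] G by auto
      with greater show ?thesis by (intro that[of z]) auto
    qed
    have "s x = (1 / h) * (x ^ i * (G (?u + h * x) - G ?u))"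
      by (simp add: s_def algebra_simps)
    also have "\<dots> = x ^ Suc i * G' \<xi>"
      using h(1) by (simp add: \<xi>(2))
    finally have "\<bar>x ^ Suc i * G' ?u - s x\<bar> = \<bar>x\<bar> ^ Suc i * \<bar>G' \<xi> - G' ?u\<bar>"
      by (metis abs_minus_commute abs_mult power_abs right_diff_distrib)
    also have "\<dots> \<le> r ^ Suc i * \<bar>G' \<xi> - G' ?u\<bar>"
      using xr by (intro mult_right_mono power_mono) auto
    also have "\<bar>G' \<xi> - G' ?u\<bar> < e / r ^ Suc i"
    proof (rule d(2))
      have "\<bar>w * x\<bar> \<le> \<bar>w\<bar> * r"
        using xr by (auto simp: abs_mult intro!: mult_left_mono)
      then show "\<bar>?u\<bar> \<le> R'"
        unfolding R'_def by linarith
      have "\<bar>h * x\<bar> \<le> h * r"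
        using xr h(1) by (auto simp: abs_mult)
      then show "\<bar>\<xi> - ?u\<bar> < d"
        using \<xi>(1) h(2) by linarith
    qed
    finally show ?thesis
      using r by (simp add: field_simps)
  qed
  with s show "\<exists>s\<in>kernel_closure K. \<forall>x. \<bar>x\<bar> \<le> R \<longrightarrow> \<bar>x ^ Suc i * G' (w * x + b) - s x\<bar> < e"
    by blast
qed

text \<open>The \<open>i\<close>-th derivative of the \<open>k\<close>-fold box average of \<open>K\<close>.\<close>

definition average_deriv :: "(real \<Rightarrow> real) \<Rightarrow> real \<Rightarrow> nat \<Rightarrow> nat \<Rightarrow> real \<Rightarrow> real" where
  "average_deriv K \<eta> k i = (difference_quotient \<eta> ^^ i) ((box_average \<eta> ^^ (k - i)) K)"

text \<open>Differentiation trades the outermost remaining average for a difference quotient;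
  \<open>i < k\<close> guarantees that one is left.\<close>

lemma average_deriv_deriv:
  assumes "continuous_on UNIV K" "i < k"
  shows "(average_deriv K \<eta> k i has_real_derivative average_deriv K \<eta> k (Suc i) x) (at x)"
proof -
  obtain m where m: "k - i = Suc m" "k - Suc i = m"
    using assms(2) by (metis Suc_diff_Suc)
  let ?F = "(box_average \<eta> ^^ m) K"
  have "((difference_quotient \<eta> ^^ i) (box_average \<eta> ?F) has_real_derivative
      (difference_quotient \<eta> ^^ i) (difference_quotient \<eta> ?F) x) (at x)"
    by (intro difference_quotient_funpow_deriv box_average_deriv continuous_on_box_average_funpow assms)
  then show ?thesis
    unfolding average_deriv_def m by (simp add: funpow_swap1)
qed

text \<open>Each differentiation in \<open>w\<close> contributes one factor \<open>x\<close>. The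
  last derivative is still continuous, being built from difference quotients of
  \<open>K\<close>.\<close>

lemma kernel_closure_average_deriv:
  assumes "continuous_on UNIV K" "0 < \<eta>" "i \<le> k"
  shows "(\<lambda>x. x ^ i * average_deriv K \<eta> k i (w * x + b)) \<in> kernel_closure K"
  using assms(3)
proof (induction i arbitrary: w b)
  case 0
  show ?case
    using kernel_closure_box_average_funpow[OF assms(1,2)] by (simp add: average_deriv_def)
next
  case (Suc i)
  show ?case
  proof (rule kernel_closure_deriv)
    show "(average_deriv K \<eta> k i has_real_derivative average_deriv K \<eta> k (Suc i) x) (at x)" for x
      using Suc.prems by (intro average_deriv_deriv assms) auto
    show "continuous_on UNIV (average_deriv K \<eta> k (Suc i))"
      unfolding average_deriv_def
      by (intro continuous_on_difference_quotient_funpow continuous_on_box_average_funpow assms)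
    show "(\<lambda>x. x ^ i * average_deriv K \<eta> k i (w * x + b)) \<in> kernel_closure K" for w b
      using Suc by auto
  qed
qed

section \<open>Limits of polynomials of bounded degree, and density\<close>

text \<open>A polynomial of degree below \<open>k\<close> is the Lagrange interpolant of its values
  at \<open>0, ..., k - 1\<close>. These finitely many values converge, so the limit is the
  interpolant of the values of \<open>K\<close>.\<close>

lemma is_polynomial_fun_limit:
  fixes f :: "nat \<Rightarrow> real \<Rightarrow> real"
  assumes "\<And>n x. f n x = (\<Sum>i<k. c n i * x ^ i)" and "\<And>x. (\<lambda>n. f n x) \<longlonglongrightarrow> K x"
  shows "is_polynomial_fun K"
proof -
  \<comment> \<open>Lagrange basis polynomial of node \<open>i\<close> among the nodes
    \<open>0, ..., k - 1\<close>.\<close>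
  define L :: "nat \<Rightarrow> real poly" where
    "L i = (\<Prod>j\<in>{..<k} - {i}. [:- real j / (real i - real j), 1 / (real i - real j):])" for i
  have degL: "degree (L i) < k" if "i < k" for i
  proof -
    have "degree (L i) \<le> (\<Sum>j\<in>{..<k} - {i}. degree [:- real j / (real i - real j), 1 / (real i - real j):])"
      unfolding L_def by (metis (no_types, lifting) degree_prod_sum_le finite_Diff finite_lessThan o_apply sum.cong)
    also have "\<dots> \<le> (\<Sum>j\<in>{..<k} - {i}. 1)"
      by (intro sum_mono) (auto intro: order_trans[OF degree_pCons_le])
    also have "\<dots> < k"
      using that by simp
    finally show ?thesis .
  qed
  have L: "poly (L i) (real j) = (if i = j then 1 else 0)" if "i < k" "j < k" for i j
  proof (cases "i = j")
    case True
    then show ?thesis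
      by (auto simp: L_def poly_prod diff_divide_distrib[symmetric] intro!: prod.neutral)
  next
    case False
    have "(\<Prod>l\<in>{..<k} - {i}. poly [:- real l / (real i - real l), 1 / (real i - real l):] (real j)) = 0"
      using that False by (intro prod_zero) (auto intro!: bexI[of _ j])
    with False show ?thesis
      by (simp add: L_def poly_prod)
  qed
  have interpolation: "f n x = (\<Sum>i<k. f n (real i) * poly (L i) x)" for n x
  \<comment> \<open>For \<open>k = 0\<close> the strict degree bounds below are impossible, and the
    claim is about empty sums.\<close>
  proof (cases "k = 0")
    case False
    define p where "p = (\<Sum>i<k. monom (c n i) i)"
    have p: "poly p x = f n x" for x
      by (simp add: p_def poly_sum poly_monom assms(1))
    define q where "q = (\<Sum>i<k. smult (f n (real i)) (L i))"
    have q: "poly q x = (\<Sum>i<k. f n (real i) * poly (L i) x)" for x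
      by (simp add: q_def poly_sum)
    \<comment> \<open>Both have degree below \<open>k\<close> and agree at \<open>k\<close>
      nodes.\<close>
    have "p = q"
    proof (rule poly_eqI_degree[of "real ` {..<k}"])
      show "poly p x = poly q x" if x: "x \<in> real ` {..<k}" for x
      proof -
        obtain j where j: "x = real j" "j < k"
          using x by (elim imageE) simp
        have "poly q x = (\<Sum>i<k. if i = j then f n (real i) else 0)"
          unfolding q using j by (intro sum.cong) (auto simp: L)
        also have "\<dots> = f n x"
          using j by (simp add: sum.delta)
        finally show ?thesis
          by (simp add: p)
      qed
      have card: "card (real ` {..<k}) = k"
        by (simp add: card_image)
      show "degree p < card (real ` {..<k})"
        unfolding card p_def using False
        by (intro degree_sum_less) (auto intro: le_less_trans[OF degree_monom_le])
      show "degree q < card (real ` {..<k})"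
        unfolding card q_def using False degL
        by (intro degree_sum_less) (auto intro: le_less_trans[OF degree_smult_le])
    qed
    with p q show ?thesis by metis
  qed (simp add: assms(1))
  have "K x = poly (\<Sum>i<k. smult (K (real i)) (L i)) x" for x
  proof (rule LIMSEQ_unique[OF assms(2)])
    have "(\<lambda>n. \<Sum>i<k. f n (real i) * poly (L i) x) \<longlonglongrightarrow> (\<Sum>i<k. K (real i) * poly (L i) x)"
      by (intro tendsto_intros assms(2))
    then show "(\<lambda>n. f n x) \<longlonglongrightarrow> poly (\<Sum>i<k. smult (K (real i)) (L i)) x"
      by (simp add: interpolation[symmetric] poly_sum)
  qed
  then show ?thesis
    unfolding is_polynomial_fun_def by blast
qed

lemma box_average_funpow_tendsto:
  assumes "continuous_on UNIV K"
  shows "(\<lambda>n. (box_average (1 / real (Suc n)) ^^ k) K x) \<longlonglongrightarrow> K x"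
proof (rule LIMSEQ_I)
  fix e :: real
  assume "0 < e"
  then obtain d where d: "0 < d" "\<And>y. \<bar>y - x\<bar> < d \<Longrightarrow> \<bar>K y - K x\<bar> < e / 2"
    using continuous_modulus_on_bounded[OF assms, of "e / 2" "\<bar>x\<bar>"] by (metis half_gt_zero order_refl)
  \<comment> \<open>From \<open>N\<close> on, the averaging window of length
    \<open>real k / real (Suc n)\<close> is shorter than \<open>d\<close>.\<close>
  obtain N :: nat where N: "real k / d < real N"
    using reals_Archimedean2 by blast
  have "norm ((box_average (1 / real (Suc n)) ^^ k) K x - K x) < e" if "N \<le> n" for n
  proof -
    have "real k / d < real (Suc n)"
      using N that by linarith
    then have "real k * (1 / real (Suc n)) < d"
      using d(1) by (simp add: field_simps)
    then have "\<bar>(box_average (1 / real (Suc n)) ^^ k) K x - K x\<bar> \<le> e / 2"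
      by (intro box_average_funpow_near assms less_imp_le[OF d(2)]) auto
    with \<open>0 < e\<close> show ?thesis by simp
  qed
  then show "\<exists>N. \<forall>n\<ge>N. norm ((box_average (1 / real (Suc n)) ^^ k) K x - K x) < e"
    by blast
qed

lemma kernel_closure_monomial:
  assumes "continuous_on UNIV K" "\<not> is_polynomial_fun K"
  shows "(\<lambda>x. x ^ k) \<in> kernel_closure K"
proof (cases "\<exists>\<eta>>0. \<exists>b. average_deriv K \<eta> k k b \<noteq> 0")
  case True
  then obtain \<eta> b where \<eta>: "0 < \<eta>" "average_deriv K \<eta> k k b \<noteq> 0"
    by blast
  \<comment> \<open>At \<open>w = 0\<close> the derivative factor is a nonzero constant, which
    scaling removes.\<close>
  have "(\<lambda>x. x ^ k * average_deriv K \<eta> k k (0 * x + b)) \<in> kernel_closure K"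
    using assms \<eta> by (intro kernel_closure_average_deriv) auto
  from kernel_closure_scale[OF this, of "1 / average_deriv K \<eta> k k b"] \<eta>(2)
  show ?thesis by simp
next
  case False
  have "\<exists>c. \<forall>x. (box_average \<eta> ^^ k) K x = (\<Sum>i<k. c i * x ^ i)" if "0 < \<eta>" for \<eta>
  proof (intro exI allI)
    fix x
    \<comment> \<open>Taylor expansion at 0: the Lagrange remainder contains the \<open>k\<close>-th
      derivative, which vanishes everywhere in this case.\<close>
    obtain t where "average_deriv K \<eta> k 0 x =
        (\<Sum>m<k. average_deriv K \<eta> k m 0 / fact m * x ^ m) + average_deriv K \<eta> k k t / fact k * x ^ k"
      using Maclaurin_bi_le[of "average_deriv K \<eta> k" "average_deriv K \<eta> k 0" k x]
        average_deriv_deriv[OF assms(1)] by auto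
    then show "(box_average \<eta> ^^ k) K x = (\<Sum>m<k. (average_deriv K \<eta> k m 0 / fact m) * x ^ m)"
      using False that by (simp add: average_deriv_def)
  qed
  then have "\<exists>c. \<forall>n x. (box_average (1 / real (Suc n)) ^^ k) K x = (\<Sum>i<k. c n i * x ^ i)"
    by (intro choice) auto
  then have "is_polynomial_fun K"
    using is_polynomial_fun_limit[where f = "\<lambda>n. (box_average (1 / real (Suc n)) ^^ k) K"]
      box_average_funpow_tendsto[OF assms(1)] by blast
  with assms(2) show ?thesis by blast
qed

theorem kernel_span_dense:
  assumes "continuous_on UNIV K" "\<not> is_polynomial_fun K" "compact T" "continuous_on T g" "0 < e"
  obtains s where "s \<in> kernel_span K" "\<And>x. x \<in> T \<Longrightarrow> \<bar>g x - s x\<bar> < e"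
proof -
  obtain R where R: "\<And>x. x \<in> T \<Longrightarrow> \<bar>x\<bar> \<le> R"
    using compact_imp_bounded[OF assms(3)] by (auto simp: bounded_iff)
  obtain p where p: "real_polynomial_function p" "\<And>x. x \<in> T \<Longrightarrow> \<bar>g x - p x\<bar> < e / 2"
    using Stone_Weierstrass_real_polynomial_function[OF assms(3,4), of "e / 2"] assms(5) by auto
  obtain a n where "p = (\<lambda>x. \<Sum>i\<le>n. a i * x ^ i)"
    using p(1) unfolding real_polynomial_function_iff_sum by blast
  then have "p \<in> kernel_closure K"
    using assms by (auto intro!: kernel_closure_sum kernel_closure_scale kernel_closure_monomial)
  then obtain s where s: "s \<in> kernel_span K" "\<And>x. \<bar>x\<bar> \<le> R \<Longrightarrow> \<bar>p x - s x\<bar> < e / 2"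
    using kernel_closureD[of p K "e / 2" R] assms(5) by auto
  have "\<bar>g x - s x\<bar> < e" if "x \<in> T" for x
    using p(2)[OF that] s(2)[OF R[OF that]] by linarith
  with s(1) show ?thesis by (rule that)
qed

section \<open>Cells and separating perturbations\<close>

lemma uniform_positive_bound:
  fixes P :: "'a \<Rightarrow> real \<Rightarrow> bool"
  assumes "finite A" "\<And>a. a \<in> A \<Longrightarrow> \<exists>d>0. P a d"
    and "\<And>a d d'. P a d \<Longrightarrow> 0 < d' \<Longrightarrow> d' \<le> d \<Longrightarrow> P a d'"
  obtains d where "0 < d" "\<And>a. a \<in> A \<Longrightarrow> P a d"
proof -
  obtain D where D: "\<And>a. a \<in> A \<Longrightarrow> 0 < D a \<and> P a (D a)"
    using assms(2) by metis
  \<comment> \<open>Inserting 1 keeps the minimum meaningful for empty \<open>A\<close>.\<close>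
  define d where "d = Min (insert 1 (D ` A))"
  have d: "0 < d"
    using assms(1) D by (auto simp: d_def)
  have "d \<le> D a" if "a \<in> A" for a
    using assms(1) that by (auto simp: d_def)
  with d D assms(3) show ?thesis
    by (intro that[of d]) blast+
qed

lemma continuous_on_closed_UN_finite:
  fixes f :: "'a::topological_space \<Rightarrow> 'b::topological_space"
  assumes "finite J" "\<And>j. j \<in> J \<Longrightarrow> closed (I j)" "\<And>j. j \<in> J \<Longrightarrow> continuous_on (I j) f"
  shows "continuous_on (\<Union>j\<in>J. I j) f"
  using assms
proof (induction J)
  case (insert j J)
  have "continuous_on (I j \<union> (\<Union>j\<in>J. I j)) f"
    by (intro continuous_on_closed_Un closed_UN) (use insert in auto)
  then show ?case by simp
qed auto

text \<open>For each \<open>q\<close> the gaps between the cells have length \<open>1 / N\<close> and period \<open>m / N\<close>, and the gaps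
  of different \<open>q < m\<close> are disjoint translates of each other.\<close>

lemma shifted_cells:
  fixes m :: nat and \<eta> :: real
  assumes "0 < m" "0 < \<eta>"
  obtains N :: nat and I :: "nat \<Rightarrow> nat \<Rightarrow> real set"
  where "\<And>q j. closed (I q j)"
    and "\<And>q j t t'. t \<in> I q j \<Longrightarrow> t' \<in> I q j \<Longrightarrow> \<bar>t - t'\<bar> < \<eta>"
    and "\<And>q j j' t. t \<in> I q j \<Longrightarrow> t \<in> I q j' \<Longrightarrow> j = j'"
    and "\<And>t q q'. t \<in> {0..1} \<Longrightarrow> q < m \<Longrightarrow> q' < m \<Longrightarrow>
      t \<notin> (\<Union>j\<le>N. I q j) \<Longrightarrow> t \<notin> (\<Union>j\<le>N. I q' j) \<Longrightarrow> q = q'"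
proof -
  \<comment> \<open>Cells will have length \<open>(m - 1) / M\<close>, which this bound on
    \<open>M\<close> keeps below \<eta>.\<close>
  obtain M :: nat where M: "real m / \<eta> < real M"
    using reals_Archimedean2 by blast
  have M0: "0 < real M"
    using M assms by (meson divide_pos_pos less_trans of_nat_0_less_iff)
  \<comment> \<open>Cell \<open>j\<close> is followed by the gap from \<open>(m * j + q) / M\<close>
    to \<open>(m * j + q + 1) / M\<close>. Subtracting \<open>real m\<close> after the conversion
    avoids truncation for cells that begin left of 0.\<close>
  define I where "I q j = {(real (m * j + q + 1) - real m) / real M..real (m * j + q) / real M}" for q j
  have mem: "t \<in> I q j \<longleftrightarrow> real m * real j + real q + 1 - real m \<le> t * real M \<and> t * real M \<le> real m * real j + real q" for t q j
    using M0 by (auto simp: I_def field_simps)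
  have small: "\<bar>t - t'\<bar> < \<eta>" if "t \<in> I q j" "t' \<in> I q j" for q j t t'
  proof -
    have "\<bar>t * real M - t' * real M\<bar> < real m"
      using that unfolding mem by linarith
    also have "real m < \<eta> * real M"
      using M assms by (simp add: field_simps)
    finally have "\<bar>t - t'\<bar> * real M < \<eta> * real M"
      by (metis abs_mult abs_of_nat left_diff_distrib)
    with M0 show ?thesis by simp
  qed
  have separated: "j' \<le> j" if "t \<in> I q j" "t \<in> I q j'" for q j j' t
  proof (rule ccontr)
    assume "\<not> j' \<le> j"
    then have "m * (j + 1) \<le> m * j'"
      by (intro mult_left_mono) auto
    then have "real m * real j + real m \<le> real m * real j'"
      by (metis of_nat_mult of_nat_add of_nat_le_iff distrib_left mult.right_neutral)
    with that show False
      unfolding mem by linarith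
  qed
  \<comment> \<open>\<open>t * M\<close> lies between its floor and the next integer, so only the
    index congruent to that floor modulo \<open>m\<close> can have \<open>t\<close> in its
    gap.\<close>
  have gap: "q = nat \<lfloor>t * real M\<rfloor> mod m" if t: "t \<in> {0..1}" and q: "q < m" and bad: "t \<notin> (\<Union>j\<le>M + 1. I q j)" for t q
  proof (rule ccontr)
    define s where "s = t * real M"
    define u where "u = nat \<lfloor>s\<rfloor>"
    define j where "j = u div m"
    define r where "r = u mod m"
    assume "q \<noteq> nat \<lfloor>t * real M\<rfloor> mod m"
    then have neq: "q \<noteq> r"
      by (simp add: r_def u_def s_def)
    have s: "0 \<le> s" "s \<le> real M"
      using t M0 by (auto simp: s_def mult_left_le_one_le)
    have u: "real u \<le> s" "s < real u + 1"
      using s(1) by (auto simp: u_def)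
    have "u \<le> M"
      using u(1) s(2) by linarith
    moreover have "j \<le> u"
      by (simp add: j_def)
    ultimately have jM: "j \<le> M" by linarith
    have ueq: "real u = real m * real j + real r"
      by (metis j_def r_def mult_div_mod_eq of_nat_add of_nat_mult)
    have r: "r < m"
      using assms(1) by (simp add: r_def)
    show False
    \<comment> \<open>Indices above the remainder \<open>r\<close> have \<open>t\<close> in cell
      \<open>j\<close>, those below it in cell \<open>j + 1\<close>; since \<open>j \<le> M\<close>,
      cells up to \<open>M + 1\<close> suffice.\<close>
    proof (cases "r < q")
      case True
      have "t \<in> I q j"
        unfolding mem s_def[symmetric] using True r q u ueq by linarith
      with bad jM show False by force
    next
      case False
      have "t \<in> I q (j + 1)"
        unfolding mem s_def[symmetric] using False neq r q u ueq
        by (simp add: distrib_left)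
      with bad jM show False by force
    qed
  qed
  show ?thesis
  proof (rule that[of I "M + 1"])
    show "closed (I q j)" for q j
      by (simp add: I_def)
    show "j = j'" if "t \<in> I q j" "t \<in> I q j'" for q j j' t
      using separated that by (meson le_antisym)
    show "q = q'" if "t \<in> {0..1}" "q < m" "q' < m" "t \<notin> (\<Union>j\<le>M + 1. I q j)" "t \<notin> (\<Union>j\<le>M + 1. I q' j)" for t q q'
      using gap that by metis
  qed (use small in blast)
qed

section \<open>Generic perturbation of finitely many values\<close>

text \<open>Choose the values one at a time. A relation with a nonzero coefficient at the new entry
  forces its value, and finitely many coefficient choices force only finitely many values, while the
  allowed interval is infinite.\<close>

lemma perturb_linear_independent:
  fixes u :: "'a \<Rightarrow> real" and C :: "real set"
  assumes "finite A" "finite C" "0 < \<delta>"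
  shows "\<exists>v. (\<forall>a. \<bar>v a - u a\<bar> < \<delta>) \<and>
    (\<forall>c. (\<forall>a\<in>A. c a \<in> C) \<longrightarrow> (\<Sum>a\<in>A. c a * v a) = 0 \<longrightarrow> (\<forall>a\<in>A. c a = 0))"
  using assms(1)
proof (induction A)
  case empty
  show ?case
    using assms(3) by (intro exI[of _ u]) auto
next
  case (insert a A)
  obtain v where v: "\<And>a. \<bar>v a - u a\<bar> < \<delta>"
    "\<And>c. (\<forall>a\<in>A. c a \<in> C) \<Longrightarrow> (\<Sum>a\<in>A. c a * v a) = 0 \<Longrightarrow> (\<forall>a\<in>A. c a = 0)"
    using insert.IH by blast
  \<comment> \<open>The forced values. Extensional coefficient functions keep this set finite, and
    \<open>k = 0\<close> merely adds the value 0 because division by zero yields 0.\<close>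
  define B where "B = (\<lambda>(c, k). - (\<Sum>a\<in>A. c a * v a) / k) ` ((A \<rightarrow>\<^sub>E C) \<times> C)"
  have "finite B"
    unfolding B_def using insert.hyps(1) assms(2) by (intro finite_imageI finite_cartesian_product finite_PiE)
  moreover have "infinite {u a - \<delta><..<u a + \<delta>}"
    using assms(3) by (simp add: infinite_Ioo_iff)
  ultimately obtain y where y: "y \<in> {u a - \<delta><..<u a + \<delta>}" "y \<notin> B"
    by (meson finite_subset subsetI)
  show ?case
  proof (intro exI[of _ "v(a := y)"] conjI allI impI)
    show "\<bar>(v(a := y)) b - u b\<bar> < \<delta>" for b
      using v(1)[of b] y(1) by (auto simp: abs_less_iff)
    fix c
    assume c: "\<forall>b\<in>insert a A. c b \<in> C" "(\<Sum>b\<in>insert a A. c b * (v(a := y)) b) = 0"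
    have "(\<Sum>b\<in>A. c b * (v(a := y)) b) = (\<Sum>b\<in>A. c b * v b)"
      using insert.hyps by (intro sum.cong) auto
    with c(2) insert.hyps have eq: "c a * y + (\<Sum>b\<in>A. c b * v b) = 0"
      by simp
    have "c a = 0"
    proof (rule ccontr)
      assume "c a \<noteq> 0"
      with eq have "y = - (\<Sum>b\<in>A. c b * v b) / c a"
        by (simp add: field_simps)
      also have "(\<Sum>b\<in>A. c b * v b) = (\<Sum>b\<in>A. restrict c A b * v b)"
        by (intro sum.cong) auto
      finally have "y = (\<lambda>(c, k). - (\<Sum>a\<in>A. c a * v a) / k) (restrict c A, c a)"
        by simp
      moreover have "(restrict c A, c a) \<in> (A \<rightarrow>\<^sub>E C) \<times> C"
        using c(1) by auto
      ultimately have "y \<in> B"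
        unfolding B_def by (rule image_eqI)
      with y(2) show False by blast
    qed
    with eq c(1) v(2)[of c] show "\<forall>b\<in>insert a A. c b = 0"
      by auto
  qed
qed

text \<open>Two index choices with equal sums give a vanishing combination whose coefficients are
  the difference of their indicators, hence in \<open>{-1, 0, 1}\<close>. Independence over that set
  makes the choices equal.\<close>

lemma perturb_injective_sums:
  fixes u :: "'d::finite \<Rightarrow> nat \<Rightarrow> real"
  assumes "0 < \<delta>"
  obtains v where "\<And>p j. \<bar>v p j - u p j\<bar> < \<delta>" "inj_on (\<lambda>J. \<Sum>p\<in>UNIV. v p (J p)) {J. \<forall>p. J p \<le> (N::nat)}"
proof -
  have "finite (UNIV \<times> {..N} :: ('d \<times> nat) set)" "finite {-1, 0, 1 :: real}"
    by auto
  from perturb_linear_independent[OF this assms, of "\<lambda>(p, j). u p j"]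
  obtain w where w: "\<And>a. \<bar>w a - (\<lambda>(p, j). u p j) a\<bar> < \<delta>"
    "\<And>c. (\<forall>a\<in>UNIV \<times> {..N}. c a \<in> {-1, 0, 1}) \<Longrightarrow> (\<Sum>a\<in>UNIV \<times> {..N}. c a * w a) = 0 \<Longrightarrow> (\<forall>a\<in>UNIV \<times> {..N}. c a = 0)"
    by blast
  show ?thesis
  proof (rule that[of "\<lambda>p j. w (p, j)"])
    show "\<bar>w (p, j) - u p j\<bar> < \<delta>" for p j
      using w(1)[of "(p, j)"] by simp
    show "inj_on (\<lambda>J. \<Sum>p\<in>UNIV. w (p, J p)) {J. \<forall>p. J p \<le> N}"
    proof (rule inj_onI)
      fix J J' :: "'d \<Rightarrow> nat"
      assume J: "J \<in> {J. \<forall>p. J p \<le> N}" "J' \<in> {J. \<forall>p. J p \<le> N}"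
        and eq: "(\<Sum>p\<in>UNIV. w (p, J p)) = (\<Sum>p\<in>UNIV. w (p, J' p))"
      define c :: "'d \<times> nat \<Rightarrow> real" where
        "c = (\<lambda>(p, j). (if j = J p then 1 else 0) - (if j = J' p then 1 else 0))"
      have "(\<Sum>a\<in>UNIV \<times> {..N}. c a * w a) = (\<Sum>p\<in>UNIV. \<Sum>j\<le>N. c (p, j) * w (p, j))"
        by (simp add: sum.cartesian_product)
      also have "\<dots> = (\<Sum>p\<in>UNIV. w (p, J p) - w (p, J' p))"
      proof (rule sum.cong[OF refl])
        fix p
        have "(\<Sum>j\<le>N. c (p, j) * w (p, j)) =
            (\<Sum>j\<le>N. (if j = J p then w (p, j) else 0) - (if j = J' p then w (p, j) else 0))"
          by (intro sum.cong) (auto simp: c_def)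
        also have "\<dots> = w (p, J p) - w (p, J' p)"
          using J by (simp add: sum_subtractf)
        finally show "(\<Sum>j\<le>N. c (p, j) * w (p, j)) = w (p, J p) - w (p, J' p)" .
      qed
      also have "\<dots> = 0"
        using eq by (simp add: sum_subtractf)
      finally have sum0: "(\<Sum>a\<in>UNIV \<times> {..N}. c a * w a) = 0" .
      have "\<forall>a\<in>UNIV \<times> {..N}. c a = 0"
        by (rule w(2)[OF _ sum0]) (auto simp: c_def)
      then have zero: "c (p, J p) = 0" for p
        using J by auto
      have "J p = J' p" for p
        using zero[of p] by (simp add: c_def split: if_splits)
      then show "J = J'" by blast
    qed
  qed
qed

section \<open>Approximate superposition\<close>

lemma continuous_on_inner_sum:
  fixes \<phi> :: "'d::finite \<Rightarrow> real \<Rightarrow> real"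
  assumes "\<And>p. continuous_on {0..1} (\<phi> p)"
  shows "continuous_on (cbox 0 1) (\<lambda>x :: real^'d. \<Sum>p\<in>UNIV. \<phi> p (x $ p))"
  by (intro continuous_on_sum continuous_on_compose2[OF assms] continuous_intros)
    (auto simp: mem_box_cart)

text \<open>The inner sums range over a bounded set, where each outer function has a modulus of
  continuity, and finitely many moduli have a common lower bound. One \<delta> serves all new inner
  functions, which are chosen only later.\<close>

lemma inner_sum_perturbation:
  fixes \<phi> :: "'d::finite \<Rightarrow> nat \<Rightarrow> real \<Rightarrow> real" and \<Phi> :: "nat \<Rightarrow> real \<Rightarrow> real"
  assumes \<Phi>: "\<And>q. q < m \<Longrightarrow> continuous_on UNIV (\<Phi> q)"
    and \<phi>: "\<And>p q. q < m \<Longrightarrow> continuous_on {0..1} (\<phi> p q)"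
    and "0 < e"
  obtains \<delta> where "0 < \<delta>"
    "\<And>\<phi>' q x. (\<And>p t. t \<in> {0..1} \<Longrightarrow> \<bar>\<phi>' p t - \<phi> p q t\<bar> \<le> \<delta>) \<Longrightarrow> q < m \<Longrightarrow> x \<in> cbox 0 1 \<Longrightarrow>
      \<bar>\<Phi> q (\<Sum>p\<in>UNIV. \<phi>' p ((x :: real^'d) $ p)) - \<Phi> q (\<Sum>p\<in>UNIV. \<phi> p q (x $ p))\<bar> < e"
proof -
  define P where "P q d \<longleftrightarrow> (\<forall>x\<in>cbox 0 (1 :: real^'d). \<forall>y. \<bar>y - (\<Sum>p\<in>UNIV. \<phi> p q (x $ p))\<bar> < d \<longrightarrow>
      \<bar>\<Phi> q y - \<Phi> q (\<Sum>p\<in>UNIV. \<phi> p q (x $ p))\<bar> < e)" for q d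
  have "\<exists>d>0. P q d" if "q \<in> {..<m}" for q
  proof -
    have q: "q < m" using that by simp
    have "bounded ((\<lambda>x :: real^'d. \<Sum>p\<in>UNIV. \<phi> p q (x $ p)) ` cbox 0 1)"
      by (intro compact_imp_bounded compact_continuous_image continuous_on_inner_sum \<phi> q compact_cbox)
    then obtain R where R: "\<And>x :: real^'d. x \<in> cbox 0 1 \<Longrightarrow> \<bar>\<Sum>p\<in>UNIV. \<phi> p q (x $ p)\<bar> \<le> R"
      by (auto simp: bounded_iff)
    obtain d where "0 < d" "\<And>x y. \<bar>x\<bar> \<le> R \<Longrightarrow> \<bar>y - x\<bar> < d \<Longrightarrow> \<bar>\<Phi> q y - \<Phi> q x\<bar> < e"
      using continuous_modulus_on_bounded[OF \<Phi>[OF q] \<open>0 < e\<close>, of R] by blast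
    with R show ?thesis
      unfolding P_def by blast
  qed
  then obtain d where d: "0 < d" "\<And>q. q < m \<Longrightarrow> P q d"
    by (rule uniform_positive_bound[of "{..<m}" P, rotated]) (auto simp: P_def)
  \<comment> \<open>The sum moves by at most \<open>CARD('d) * \<delta> = d / 2\<close>, strictly
    below \<open>d\<close>.\<close>
  define \<delta> where "\<delta> = d / (2 * real CARD('d))"
  show ?thesis
  proof (rule that[of \<delta>])
    show "0 < \<delta>" using d(1) by (simp add: \<delta>_def)
    fix \<phi>' q and x :: "real^'d"
    assume \<phi>': "\<And>p t. t \<in> {0..1} \<Longrightarrow> \<bar>\<phi>' p t - \<phi> p q t\<bar> \<le> \<delta>" and q: "q < m" and x: "x \<in> cbox 0 1"
    have "\<bar>(\<Sum>p\<in>UNIV. \<phi>' p (x $ p)) - (\<Sum>p\<in>UNIV. \<phi> p q (x $ p))\<bar> \<le> (\<Sum>p\<in>UNIV. \<bar>\<phi>' p (x $ p) - \<phi> p q (x $ p)\<bar>)"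
      by (simp add: sum_subtractf[symmetric])
    also have "\<dots> \<le> (\<Sum>p\<in>(UNIV :: 'd set). \<delta>)"
      using x by (intro sum_mono \<phi>') (auto simp: mem_box_cart)
    also have "\<dots> < d"
      using d(1) by (simp add: \<delta>_def)
    finally show "\<bar>\<Phi> q (\<Sum>p\<in>UNIV. \<phi>' p (x $ p)) - \<Phi> q (\<Sum>p\<in>UNIV. \<phi> p q (x $ p))\<bar> < e"
      using d(2)[OF q] x unfolding P_def by blast
  qed
qed

lemma uniformly_continuous_coordinatewise:
  fixes r :: "real^'d \<Rightarrow> real"
  assumes "continuous_on (cbox 0 1) r" "0 < e"
  obtains \<eta> where "0 < \<eta>"
    "\<And>x y. x \<in> cbox 0 1 \<Longrightarrow> y \<in> cbox 0 1 \<Longrightarrow> (\<And>p. \<bar>x $ p - y $ p\<bar> < \<eta>) \<Longrightarrow> \<bar>r x - r y\<bar> < e"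
proof -
  have "uniformly_continuous_on (cbox 0 1) r"
    by (rule compact_uniformly_continuous[OF assms(1) compact_cbox])
  then obtain d where d: "0 < d" "\<And>x y. x \<in> cbox 0 1 \<Longrightarrow> y \<in> cbox 0 1 \<Longrightarrow> dist y x < d \<Longrightarrow> dist (r y) (r x) < e"
    unfolding uniformly_continuous_on_def using assms(2) by meson
  \<comment> \<open>The Euclidean distance is at most the sum of the \<open>CARD('d)\<close>
    coordinate distances.\<close>
  define \<eta> where "\<eta> = d / real CARD('d)"
  have "\<bar>r x - r y\<bar> < e" if "x \<in> cbox 0 1" "y \<in> cbox 0 1" "\<And>p. \<bar>x $ p - y $ p\<bar> < \<eta>" for x y
  proof -
    have "norm (x - y) \<le> (\<Sum>p\<in>UNIV. \<bar>(x - y) $ p\<bar>)"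
      by (rule norm_le_l1_cart)
    also have "\<dots> < (\<Sum>p\<in>(UNIV :: 'd set). \<eta>)"
      using that(3) by (intro sum_strict_mono) auto
    also have "\<dots> = d"
      by (simp add: \<eta>_def)
    finally have "dist x y < d"
      by (simp add: dist_norm)
    with d(2)[of y x] that show ?thesis
      by (simp add: dist_real_def)
  qed
  with d(1) show ?thesis
    by (intro that[of \<eta>]) (auto simp: \<eta>_def)
qed

text \<open>Every index is charged \<kappa>, and the at most \<open>n\<close> exceptional ones are
  charged \<open>M\<close> on top.\<close>

lemma sum_deviation_bound:
  fixes a :: "nat \<Rightarrow> real"
  assumes "B \<subseteq> {..<m}" "card B \<le> n" "0 \<le> M" "0 \<le> \<kappa>"
    and "\<And>q. q < m \<Longrightarrow> q \<notin> B \<Longrightarrow> \<bar>a q\<bar> \<le> \<kappa>" "\<And>q. q \<in> B \<Longrightarrow> \<bar>a q\<bar> \<le> M"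
  shows "\<bar>\<Sum>q<m. a q\<bar> \<le> real m * \<kappa> + real n * M"
proof -
  have "\<bar>\<Sum>q<m. a q\<bar> \<le> (\<Sum>q<m. \<bar>a q\<bar>)"
    by (rule sum_abs)
  also have "\<dots> \<le> (\<Sum>q<m. \<kappa> + (if q \<in> B then M else 0))"
    using assms by (intro sum_mono) (force intro: add_increasing)
  also have "\<dots> = real m * \<kappa> + (\<Sum>q\<in>{..<m} \<inter> B. M)"
    unfolding sum.distrib by (subst sum.inter_restrict) simp_all
  also have "(\<Sum>q\<in>{..<m} \<inter> B. M) = real (card B) * M"
    using assms(1) by (simp add: Int_absorb1)
  also have "\<dots> \<le> real n * M"
    using assms by (intro mult_right_mono) auto
  finally show ?thesis by simp
qed

text \<open>The correction \<open>v j - \<phi> t\<close> is continuous and bounded by \<delta> on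
  the closed union of the cells within \<open>{0..1}\<close>. Tietze's theorem extends it to
  \<open>{0..1}\<close> with the same bound, and it is then added to \<phi>.\<close>

lemma cellwise_constant_perturbation:
  fixes \<phi> :: "real \<Rightarrow> real" and I :: "nat \<Rightarrow> real set" and v :: "nat \<Rightarrow> real"
  assumes \<phi>: "continuous_on {0..1} \<phi>" and "0 < \<delta>"
    and closed: "\<And>j. closed (I j)"
    and disjoint: "\<And>j j' t. t \<in> I j \<Longrightarrow> t \<in> I j' \<Longrightarrow> j = j'"
    and near: "\<And>j t. t \<in> I j \<Longrightarrow> t \<in> {0..1} \<Longrightarrow> \<bar>v j - \<phi> t\<bar> \<le> \<delta>"
  obtains \<psi> where "continuous_on {0..1} \<psi>" "\<And>t. t \<in> {0..1} \<Longrightarrow> \<bar>\<psi> t - \<phi> t\<bar> \<le> \<delta>"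
    "\<And>j t. j \<le> (N::nat) \<Longrightarrow> t \<in> I j \<Longrightarrow> t \<in> {0..1} \<Longrightarrow> \<psi> t = v j"
proof -
  define D where "D = (\<Union>j\<le>N. I j \<inter> {0..1})"
  define w where "w t = v (THE j. t \<in> I j) - \<phi> t" for t
  have w: "w t = v j - \<phi> t" if "t \<in> I j" for t j
  proof -
    have "(THE j. t \<in> I j) = j"
      using that disjoint by (intro the_equality) auto
    then show ?thesis by (simp add: w_def)
  qed
  have "continuous_on (I j \<inter> {0..1}) w" for j
  proof -
    have "continuous_on (I j \<inter> {0..1}) (\<lambda>t. v j - \<phi> t)"
      by (intro continuous_intros continuous_on_subset[OF \<phi>]) auto
    then show ?thesis
      by (rule continuous_on_eq) (use w in auto)
  qed
  then have "continuous_on D w"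
    unfolding D_def by (intro continuous_on_closed_UN_finite closed_Int closed) auto
  moreover have "closedin (top_of_set {0..1}) D"
    unfolding D_def by (intro closed_subset closed_UN closed_Int closed ballI) auto
  moreover have "norm (w t) \<le> \<delta>" if "t \<in> D" for t
    using that near by (auto simp: D_def w)
  ultimately obtain g where g: "continuous_on {0..1} g" "\<And>t. t \<in> D \<Longrightarrow> g t = w t"
    "\<And>t. t \<in> {0..1} \<Longrightarrow> norm (g t) \<le> \<delta>"
    using Tietze[of D w "{0..1}" \<delta>] \<open>0 < \<delta>\<close> by auto
  show ?thesis
  proof (rule that[of "\<lambda>t. \<phi> t + g t"])
    show "continuous_on {0..1} (\<lambda>t. \<phi> t + g t)"
      by (intro continuous_intros \<phi> g)
    show "\<bar>\<phi> t + g t - \<phi> t\<bar> \<le> \<delta>" if "t \<in> {0..1}" for t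
      using g(3)[OF that] by simp
    show "\<phi> t + g t = v j" if "j \<le> N" "t \<in> I j" "t \<in> {0..1}" for j t
    proof -
      have "t \<in> D"
        using that by (auto simp: D_def)
      then show ?thesis
        using g(2) w[OF that(2)] by simp
    qed
  qed
qed

text \<open>The inner functions are made constant on the cells, with values whose coordinate sums separate
  the product cells, so \<open>\<Phi> q\<close> can be prescribed as \<open>r / m\<close> on each product cell. A point lies in a
  gap of \<open>q\<close> in some coordinate for at most \<open>d\<close> of the \<open>m = 2 * d + 1\<close> indices \<open>q\<close>, and each such
  \<open>q\<close> costs at most \<open>2 * M / m\<close>.\<close>

lemma superposition_step:
  fixes r :: "real^'d \<Rightarrow> real" and \<phi> :: "'d \<Rightarrow> nat \<Rightarrow> real \<Rightarrow> real"
  defines "m \<equiv> 2 * CARD('d) + 1"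
  assumes r: "continuous_on (cbox 0 1) r" and M: "\<And>x. x \<in> cbox 0 1 \<Longrightarrow> \<bar>r x\<bar> \<le> M"
    and \<phi>: "\<And>p q. q < m \<Longrightarrow> continuous_on {0..1} (\<phi> p q)"
    and "0 < \<delta>" "0 < \<kappa>"
  shows "\<exists>\<phi>' \<Phi>. (\<forall>p. \<forall>q<m. continuous_on {0..1} (\<phi>' p q)) \<and>
    (\<forall>p. \<forall>q<m. \<forall>t\<in>{0..1}. \<bar>\<phi>' p q t - \<phi> p q t\<bar> \<le> \<delta>) \<and>
    (\<forall>q<m. continuous_on UNIV (\<Phi> q)) \<and>
    (\<forall>x\<in>cbox 0 1. \<bar>r x - (\<Sum>q<m. \<Phi> q (\<Sum>p\<in>UNIV. \<phi>' p q (x $ p)))\<bar> \<le>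
        \<kappa> + 2 * real CARD('d) / real m * M)"
proof -
  have m: "0 < m" by (simp add: m_def)
  have M0: "0 \<le> M"
    using M[of 0] by (simp add: mem_box_cart)
  obtain \<eta>\<^sub>r where \<eta>\<^sub>r: "0 < \<eta>\<^sub>r"
    "\<And>x y. x \<in> cbox 0 1 \<Longrightarrow> y \<in> cbox 0 1 \<Longrightarrow> (\<And>p. \<bar>x $ p - y $ p\<bar> < \<eta>\<^sub>r) \<Longrightarrow> \<bar>r x - r y\<bar> < \<kappa>"
    using uniformly_continuous_coordinatewise[OF r \<open>0 < \<kappa>\<close>] by blast
  \<comment> \<open>Half of \<delta> bounds the oscillation of the inner functions on a cell, the
    other half the perturbation that separates the sums.\<close>
  define P where "P a d \<longleftrightarrow> (\<forall>t\<in>{0..1}. \<forall>t'\<in>{0..1}. \<bar>t - t'\<bar> < d \<longrightarrow>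
      \<bar>\<phi> (fst a) (snd a) t - \<phi> (fst a) (snd a) t'\<bar> < \<delta> / 2)" for a d
  have "\<exists>d>0. P a d" if "a \<in> UNIV \<times> {..<m}" for a
  proof -
    have "uniformly_continuous_on {0..1} (\<phi> (fst a) (snd a))"
      using that by (intro compact_uniformly_continuous \<phi>) auto
    then show ?thesis
      unfolding P_def uniformly_continuous_on_def dist_real_def using \<open>0 < \<delta>\<close> by (meson half_gt_zero)
  qed
  then obtain \<eta>\<^sub>\<phi> where \<eta>\<^sub>\<phi>: "0 < \<eta>\<^sub>\<phi>" "\<And>a. a \<in> UNIV \<times> {..<m} \<Longrightarrow> P a \<eta>\<^sub>\<phi>"
    by (rule uniform_positive_bound[of "UNIV \<times> {..<m}" P, rotated]) (auto simp: P_def)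
  define \<eta> where "\<eta> = min \<eta>\<^sub>r \<eta>\<^sub>\<phi>"
  have "0 < \<eta>"
    using \<eta>\<^sub>r(1) \<eta>\<^sub>\<phi>(1) by (simp add: \<eta>_def)
  obtain N :: nat and I :: "nat \<Rightarrow> nat \<Rightarrow> real set"
    where closed: "\<And>q j. closed (I q j)"
      and small: "\<And>q j t t'. t \<in> I q j \<Longrightarrow> t' \<in> I q j \<Longrightarrow> \<bar>t - t'\<bar> < \<eta>"
      and disjoint: "\<And>q j j' t. t \<in> I q j \<Longrightarrow> t \<in> I q j' \<Longrightarrow> j = j'"
      and one_gap: "\<And>t q q'. t \<in> {0..1} \<Longrightarrow> q < m \<Longrightarrow> q' < m \<Longrightarrow>
        t \<notin> (\<Union>j\<le>N. I q j) \<Longrightarrow> t \<notin> (\<Union>j\<le>N. I q' j) \<Longrightarrow> q = q'"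
    using shifted_cells[OF m \<open>0 < \<eta>\<close>] by metis
  \<comment> \<open>A cell may protrude from \<open>{0..1}\<close>: the sample point lies in the
    cell if the two meet, and is otherwise any point of \<open>{0..1}\<close>.\<close>
  obtain s where s01: "\<And>q j. s q j \<in> {0..1}"
    and s: "\<And>q j t. t \<in> I q j \<Longrightarrow> t \<in> {0..1} \<Longrightarrow> s q j \<in> I q j"
  proof -
    have "\<exists>s. s \<in> {0..1} \<and> (\<forall>t. t \<in> I q j \<longrightarrow> t \<in> {0..1} \<longrightarrow> s \<in> I q j)" for q j
      by (cases "I q j \<inter> {0..1} = {}") force+
    then show ?thesis using that by metis
  qed
  define \<J> :: "('d \<Rightarrow> nat) set" where "\<J> = {J. \<forall>p. J p \<le> N}"
  have "\<exists>v. (\<forall>p j. \<bar>v p j - \<phi> p q (s q j)\<bar> < \<delta> / 2) \<and> inj_on (\<lambda>J. \<Sum>p\<in>UNIV. v p (J p)) \<J>" for q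
    by (rule perturb_injective_sums[of "\<delta> / 2" "\<lambda>p j. \<phi> p q (s q j)" N])
      (use \<open>0 < \<delta>\<close> in \<open>auto simp: \<J>_def\<close>)
  then obtain v where v: "\<And>q p j. \<bar>v q p j - \<phi> p q (s q j)\<bar> < \<delta> / 2"
    and inj: "\<And>q. inj_on (\<lambda>J. \<Sum>p\<in>UNIV. v q p (J p)) \<J>"
    by metis
  have v_near: "\<bar>v q p j - \<phi> p q t\<bar> \<le> \<delta>" if "q < m" "t \<in> I q j" "t \<in> {0..1}" for q p j t
  proof -
    have "\<bar>s q j - t\<bar> < \<eta>\<^sub>\<phi>"
      using small[OF s[OF that(2,3)] that(2)] by (simp add: \<eta>_def)
    then have "\<bar>\<phi> p q (s q j) - \<phi> p q t\<bar> < \<delta> / 2"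
      using \<eta>\<^sub>\<phi>(2)[of "(p, q)"] s01 that unfolding P_def by simp
    with v[of q p j] show ?thesis by linarith
  qed
  have "\<exists>\<psi>. continuous_on {0..1} \<psi> \<and> (\<forall>t\<in>{0..1}. \<bar>\<psi> t - \<phi> p q t\<bar> \<le> \<delta>) \<and>
      (\<forall>j t. j \<le> N \<longrightarrow> t \<in> I q j \<longrightarrow> t \<in> {0..1} \<longrightarrow> \<psi> t = v q p j)" if q: "q < m" for p q
  proof (rule cellwise_constant_perturbation[of "\<phi> p q" \<delta> "I q" "v q p" N])
    show "j = j'" if "t \<in> I q j" "t \<in> I q j'" for j j' t
      using disjoint that by blast
    show "\<bar>v q p j - \<phi> p q t\<bar> \<le> \<delta>" if "t \<in> I q j" "t \<in> {0..1}" for j t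
      using v_near[OF q] that by blast
  qed (use \<phi>[OF q] \<open>0 < \<delta>\<close> closed in blast)+
  then have "\<exists>\<phi>'. \<forall>p q. q < m \<longrightarrow> continuous_on {0..1} (\<phi>' p q) \<and>
      (\<forall>t\<in>{0..1}. \<bar>\<phi>' p q t - \<phi> p q t\<bar> \<le> \<delta>) \<and>
      (\<forall>j t. j \<le> N \<longrightarrow> t \<in> I q j \<longrightarrow> t \<in> {0..1} \<longrightarrow> \<phi>' p q t = v q p j)"
    by (intro choice allI) blast
  then obtain \<phi>' where \<phi>'_cont: "\<And>p q. q < m \<Longrightarrow> continuous_on {0..1} (\<phi>' p q)"
    and \<phi>'_near: "\<And>p q t. q < m \<Longrightarrow> t \<in> {0..1} \<Longrightarrow> \<bar>\<phi>' p q t - \<phi> p q t\<bar> \<le> \<delta>"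
    and \<phi>'_cell: "\<And>p q j t. q < m \<Longrightarrow> j \<le> N \<Longrightarrow> t \<in> I q j \<Longrightarrow> t \<in> {0..1} \<Longrightarrow> \<phi>' p q t = v q p j"
    by blast
  define y :: "nat \<Rightarrow> ('d \<Rightarrow> nat) \<Rightarrow> real^'d" where "y q J = (\<chi> p. s q (J p))" for q J
  have y: "y q J \<in> cbox 0 1" for q J
    using s01 by (simp add: y_def mem_box_cart)
  have "finite \<J>"
  proof -
    have "\<J> = (UNIV \<rightarrow>\<^sub>E {..N})"
      by (auto simp: \<J>_def PiE_def Pi_def)
    then show ?thesis by (simp add: finite_PiE)
  qed
  have "\<exists>\<Phi>. continuous_on UNIV \<Phi> \<and> (\<forall>J\<in>\<J>. \<Phi> (\<Sum>p\<in>UNIV. v q p (J p)) = r (y q J) / real m) \<and>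
      (\<forall>z. \<bar>\<Phi> z\<bar> \<le> M / real m)" for q
  proof -
    let ?S = "\<lambda>J. \<Sum>p\<in>UNIV. v q p (J p)"
    \<comment> \<open>Injectivity recovers the product cell from its sum. Even off the set of sums
      the value comes from some point of the cube, so the bound \<open>M / real m\<close> holds for
      all \<open>z\<close>.\<close>
    define h where "h z = r (y q (the_inv_into \<J> ?S z)) / real m" for z
    have "finite (?S ` \<J>)"
      using \<open>finite \<J>\<close> by simp
    then have "continuous_on (?S ` \<J>) h" "closedin (top_of_set UNIV) (?S ` \<J>)"
      by (auto intro: continuous_on_finite finite_imp_closed)
    moreover have "norm (h z) \<le> M / real m" for z
      using M[OF y] by (simp add: h_def divide_right_mono)
    ultimately obtain \<Phi> where \<Phi>: "continuous_on UNIV \<Phi>" "\<And>z. z \<in> ?S ` \<J> \<Longrightarrow> \<Phi> z = h z"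
      "\<And>z. norm (\<Phi> z) \<le> M / real m"
      using Tietze[of "?S ` \<J>" h UNIV "M / real m"] M0 by auto
    have "\<Phi> (?S J) = r (y q J) / real m" if "J \<in> \<J>" for J
      using \<Phi>(2)[of "?S J"] that by (simp add: h_def the_inv_into_f_f[OF inj])
    with \<Phi> show ?thesis by auto
  qed
  then obtain \<Phi> where \<Phi>_cont: "\<And>q. continuous_on UNIV (\<Phi> q)"
    and \<Phi>_cell: "\<And>q J. J \<in> \<J> \<Longrightarrow> \<Phi> q (\<Sum>p\<in>UNIV. v q p (J p)) = r (y q J) / real m"
    and \<Phi>_bound: "\<And>q z. \<bar>\<Phi> q z\<bar> \<le> M / real m"
    by metis
  have "\<bar>r x - (\<Sum>q<m. \<Phi> q (\<Sum>p\<in>UNIV. \<phi>' p q (x $ p)))\<bar> \<le> \<kappa> + 2 * real CARD('d) / real m * M"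
    if x: "x \<in> cbox 0 1" for x
  proof -
    have x01: "x $ p \<in> {0..1}" for p
      using x by (simp add: mem_box_cart)
    \<comment> \<open>Each index \<open>q\<close> is meant to carry an equal share
      \<open>r x / real m\<close> of the residual.\<close>
    define a where "a q = r x / real m - \<Phi> q (\<Sum>p\<in>UNIV. \<phi>' p q (x $ p))" for q
    define gap where "gap p = {q. q < m \<and> x $ p \<notin> (\<Union>j\<le>N. I q j)}" for p
    have "card (gap p) \<le> 1" for p
      using one_gap[OF x01] by (intro card_le_Suc0_iff_eq[THEN iffD2, folded One_nat_def]) (auto simp: gap_def)
    then have "(\<Sum>p\<in>UNIV. card (gap p)) \<le> (\<Sum>p\<in>(UNIV :: 'd set). 1)"
      by (intro sum_mono)
    with card_UN_le[of UNIV gap] have bad: "card (\<Union>p. gap p) \<le> CARD('d)"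
      by simp
    have a_good: "\<bar>a q\<bar> \<le> \<kappa> / real m" if q: "q < m" and "q \<notin> (\<Union>p. gap p)" for q
    proof -
      have "\<forall>p. \<exists>j\<le>N. x $ p \<in> I q j"
        using that by (auto simp: gap_def)
      then obtain J where J: "\<And>p. J p \<le> N" "\<And>p. x $ p \<in> I q (J p)"
        by metis
      have "(\<Sum>p\<in>UNIV. \<phi>' p q (x $ p)) = (\<Sum>p\<in>UNIV. v q p (J p))"
        by (intro sum.cong \<phi>'_cell q J x01 refl)
      moreover have "J \<in> \<J>"
        using J(1) by (simp add: \<J>_def)
      ultimately have "a q = (r x - r (y q J)) / real m"
        by (simp add: a_def \<Phi>_cell diff_divide_distrib)
      moreover have "\<bar>r x - r (y q J)\<bar> < \<kappa>"
      proof (rule \<eta>\<^sub>r(2)[OF x y])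
        show "\<bar>x $ p - y q J $ p\<bar> < \<eta>\<^sub>r" for p
          using small[OF J(2) s[OF J(2) x01], of p] by (simp add: y_def \<eta>_def)
      qed
      ultimately show ?thesis
        by (simp add: divide_right_mono)
    qed
    have a_bad: "\<bar>a q\<bar> \<le> 2 * M / real m" for q
    proof -
      have "\<bar>r x / real m\<bar> \<le> M / real m"
        using M[OF x] by (simp add: divide_right_mono)
      then show ?thesis
        using \<Phi>_bound[of q "\<Sum>p\<in>UNIV. \<phi>' p q (x $ p)"] unfolding a_def by linarith
    qed
    have "r x - (\<Sum>q<m. \<Phi> q (\<Sum>p\<in>UNIV. \<phi>' p q (x $ p))) = (\<Sum>q<m. a q)"
      using m by (simp add: a_def sum_subtractf)
    also have "\<bar>\<dots>\<bar> \<le> real m * (\<kappa> / real m) + real CARD('d) * (2 * M / real m)"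
      by (rule sum_deviation_bound[OF _ bad]) (use M0 \<open>0 < \<kappa>\<close> a_good a_bad in \<open>auto simp: gap_def\<close>)
    also have "\<dots> = \<kappa> + 2 * real CARD('d) / real m * M"
      using m by simp
    finally show ?thesis .
  qed
  with \<phi>'_cont \<phi>'_near \<Phi>_cont show ?thesis by blast
qed

section \<open>Iterating the contraction\<close>

text \<open>The inner functions are chosen after \<open>f\<close> and \<open>E\<close>, so each
  accuracy may use different ones.\<close>

definition superposition_within :: "(real^'d \<Rightarrow> real) \<Rightarrow> real \<Rightarrow> bool" where
  "superposition_within f E \<longleftrightarrow> (\<exists>(\<Phi> :: nat \<Rightarrow> real \<Rightarrow> real) (\<phi> :: 'd \<Rightarrow> nat \<Rightarrow> real \<Rightarrow> real).
     (\<forall>q < 2 * CARD('d) + 1. continuous_on UNIV (\<Phi> q)) \<and>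
     (\<forall>p. \<forall>q < 2 * CARD('d) + 1. continuous_on {0..1} (\<phi> p q)) \<and>
     (\<forall>x\<in>cbox 0 1. \<bar>f x - (\<Sum>q < 2 * CARD('d) + 1. \<Phi> q (\<Sum>p\<in>UNIV. \<phi> p q (x $ p)))\<bar> \<le> E))"

lemma superposition_within_mono:
  fixes f :: "real^'d \<Rightarrow> real"
  assumes "superposition_within f E" "E \<le> E'"
  shows "superposition_within f E'"
proof -
  obtain \<Phi> :: "nat \<Rightarrow> real \<Rightarrow> real" and \<phi> :: "'d \<Rightarrow> nat \<Rightarrow> real \<Rightarrow> real"
    where "\<forall>q < 2 * CARD('d) + 1. continuous_on UNIV (\<Phi> q)"
      "\<forall>p. \<forall>q < 2 * CARD('d) + 1. continuous_on {0..1} (\<phi> p q)"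
      "\<forall>x\<in>cbox 0 1. \<bar>f x - (\<Sum>q < 2 * CARD('d) + 1. \<Phi> q (\<Sum>p\<in>UNIV. \<phi> p q (x $ p)))\<bar> \<le> E"
    using assms(1) unfolding superposition_within_def by blast
  with assms(2) show ?thesis
    unfolding superposition_within_def by (intro exI[of _ \<Phi>] exI[of _ \<phi>]) force
qed

text \<open>The outer functions that approximate the residual are added to the old ones, and both
  are evaluated at the perturbed inner sums.\<close>

lemma superposition_within_contract:
  fixes f :: "real^'d \<Rightarrow> real"
  assumes f: "continuous_on (cbox 0 1) f" and "superposition_within f E" "0 < E"
  shows "superposition_within f ((4 * real CARD('d) + 1) / (4 * real CARD('d) + 2) * E)"
proof -
  define m where "m = 2 * CARD('d) + 1"
  have m: "0 < real m" by (simp add: m_def)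
  obtain \<Phi> :: "nat \<Rightarrow> real \<Rightarrow> real" and \<phi> :: "'d \<Rightarrow> nat \<Rightarrow> real \<Rightarrow> real"
    where \<Phi>: "\<And>q. q < m \<Longrightarrow> continuous_on UNIV (\<Phi> q)"
      and \<phi>: "\<And>p q. q < m \<Longrightarrow> continuous_on {0..1} (\<phi> p q)"
      and E: "\<And>x. x \<in> cbox 0 1 \<Longrightarrow> \<bar>f x - (\<Sum>q<m. \<Phi> q (\<Sum>p\<in>UNIV. \<phi> p q (x $ p)))\<bar> \<le> E"
    using assms(2) unfolding superposition_within_def m_def[symmetric] by blast
  define r where "r x = f x - (\<Sum>q<m. \<Phi> q (\<Sum>p\<in>UNIV. \<phi> p q (x $ p)))" for x
  have r: "continuous_on (cbox 0 1) r"
    unfolding r_def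
    by (intro continuous_intros f continuous_on_compose2[OF \<Phi> continuous_on_inner_sum] \<phi>) auto
  \<comment> \<open>Spent twice, on the step and on the moved old outer functions:
    \<open>2 * e = E / (2 * m)\<close> turns the factor \<open>2 * d / m\<close> into the claimed
    one, with \<open>d = CARD('d)\<close>.\<close>
  define e where "e = E / (4 * real m)"
  have e: "0 < e" "0 < e / real m"
    using \<open>0 < E\<close> m by (auto simp: e_def)
  obtain \<delta> where "0 < \<delta>" and \<delta>: "\<And>\<phi>' q x. (\<And>p t. t \<in> {0..1} \<Longrightarrow> \<bar>\<phi>' p t - \<phi> p q t\<bar> \<le> \<delta>) \<Longrightarrow>
      q < m \<Longrightarrow> x \<in> cbox 0 1 \<Longrightarrow>
      \<bar>\<Phi> q (\<Sum>p\<in>UNIV. \<phi>' p ((x :: real^'d) $ p)) - \<Phi> q (\<Sum>p\<in>UNIV. \<phi> p q (x $ p))\<bar> < e / real m"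
    by (rule inner_sum_perturbation[of m \<Phi> \<phi> "e / real m"]) (use \<Phi> \<phi> e(2) in blast)+
  obtain \<phi>' \<Phi>' where \<phi>': "\<And>p q. q < m \<Longrightarrow> continuous_on {0..1} (\<phi>' p q)"
      and \<phi>'_near: "\<And>p q t. q < m \<Longrightarrow> t \<in> {0..1} \<Longrightarrow> \<bar>\<phi>' p q t - \<phi> p q t\<bar> \<le> \<delta>"
      and \<Phi>': "\<And>q. q < m \<Longrightarrow> continuous_on UNIV (\<Phi>' q)"
      and r_approx: "\<And>x. x \<in> cbox 0 1 \<Longrightarrow> \<bar>r x - (\<Sum>q<m. \<Phi>' q (\<Sum>p\<in>UNIV. \<phi>' p q (x $ p)))\<bar> \<le>
        e + 2 * real CARD('d) / real m * E"
    using superposition_step[OF r, of E \<phi> \<delta> e] E \<phi> \<open>0 < \<delta>\<close> e(1)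
    unfolding m_def[symmetric] r_def by blast
  have "\<bar>f x - (\<Sum>q<m. \<Phi> q (\<Sum>p\<in>UNIV. \<phi>' p q (x $ p)) + \<Phi>' q (\<Sum>p\<in>UNIV. \<phi>' p q (x $ p)))\<bar> \<le>
      (4 * real CARD('d) + 1) / (4 * real CARD('d) + 2) * E" if x: "x \<in> cbox 0 1" for x
  proof -
    let ?z = "\<lambda>q. \<Sum>p\<in>UNIV. \<phi> p q (x $ p)" and ?z' = "\<lambda>q. \<Sum>p\<in>UNIV. \<phi>' p q (x $ p)"
    have "f x - (\<Sum>q<m. \<Phi> q (?z' q) + \<Phi>' q (?z' q)) =
        (r x - (\<Sum>q<m. \<Phi>' q (?z' q))) - (\<Sum>q<m. \<Phi> q (?z' q) - \<Phi> q (?z q))"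
      by (simp add: r_def sum.distrib sum_subtractf)
    moreover have "\<bar>\<Sum>q<m. \<Phi> q (?z' q) - \<Phi> q (?z q)\<bar> \<le> (\<Sum>q<m. e / real m)"
      by (intro order_trans[OF sum_abs] sum_mono less_imp_le[OF \<delta>] \<phi>'_near x) auto
    ultimately have "\<bar>f x - (\<Sum>q<m. \<Phi> q (?z' q) + \<Phi>' q (?z' q))\<bar> \<le> 2 * e + 2 * real CARD('d) / real m * E"
      using r_approx[OF x] m by simp
    also have "\<dots> = (4 * real CARD('d) + 1) / (4 * real CARD('d) + 2) * E"
    proof -
      have "4 * real CARD('d) + 2 = 2 * real m"
        by (simp add: m_def)
      with m show ?thesis
        by (simp add: e_def field_simps)
    qed
    finally show ?thesis .
  qed
  with \<phi>' \<Phi> \<Phi>' show ?thesis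
    unfolding superposition_within_def m_def[symmetric]
    by (intro exI[of _ "\<lambda>q z. \<Phi> q z + \<Phi>' q z"] exI[of _ \<phi>']) (auto intro!: continuous_on_add)
qed

theorem approximate_superposition:
  fixes f :: "real^'d \<Rightarrow> real"
  assumes f: "continuous_on (cbox 0 1) f" and "0 < e"
  shows "superposition_within f e"
proof -
  define \<theta> where "\<theta> = (4 * real CARD('d) + 1) / (4 * real CARD('d) + 2)"
  have \<theta>: "0 < \<theta>" "\<theta> < 1"
    by (auto simp: \<theta>_def add_pos_pos)
  have "bounded (f ` cbox 0 1)"
    by (intro compact_imp_bounded compact_continuous_image f compact_cbox)
  then obtain B where B: "0 < B" "\<And>x. x \<in> cbox 0 1 \<Longrightarrow> \<bar>f x\<bar> \<le> B"
    unfolding bounded_pos by auto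
  \<comment> \<open>The zero functions start with error at most \<open>B\<close>, and every
    contraction multiplies the bound by \<theta>.\<close>
  have geometric: "superposition_within f (\<theta> ^ k * B)" for k
  proof (induction k)
    case 0
    show ?case
      unfolding superposition_within_def
      by (intro exI[of _ "\<lambda>q z. 0"] exI[of _ "\<lambda>p q t. 0"]) (use B(2) in auto)
  next
    case (Suc k)
    with superposition_within_contract[OF f, of "\<theta> ^ k * B"] B(1) \<theta>(1) show ?case
      by (simp add: \<theta>_def[symmetric] mult.assoc)
  qed
  obtain k where "\<theta> ^ k < e / B"
    using real_arch_pow_inv[of "e / B" \<theta>] \<theta>(2) \<open>0 < e\<close> B(1) by auto
  then have "\<theta> ^ k * B \<le> e"
    using B(1) by (simp add: field_simps)
  from superposition_within_mono[OF geometric this] show ?thesis .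
qed

section \<open>Passing from continuous functions to the kernel span\<close>

theorem mainTheorem1:
  fixes K :: "real \<Rightarrow> real"
    and f :: "real ^ 'd \<Rightarrow> real"
    and \<epsilon> :: real
  assumes "continuous_on UNIV K"
    and "\<not> is_polynomial_fun K"
    and "continuous_on (cbox 0 1) f"
    and "\<epsilon> > 0"
  shows "\<exists>(\<Phi> :: nat \<Rightarrow> real \<Rightarrow> real) (\<phi> :: 'd \<Rightarrow> nat \<Rightarrow> real \<Rightarrow> real).
           (\<forall>q < 2 * CARD('d) + 1. \<Phi> q \<in> kernel_span K) \<and>
           (\<forall>p. \<forall>q < 2 * CARD('d) + 1. \<phi> p q \<in> kernel_span K) \<and>
           (SUP x\<in>cbox 0 1. \<bar>f x - (\<Sum>q < 2 * CARD('d) + 1. \<Phi> q (\<Sum>p\<in>UNIV. \<phi> p q (x $ p)))\<bar>) < \<epsilon>"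
proof -
  define m where "m = 2 * CARD('d) + 1"
  have m: "0 < real m" by (simp add: m_def)
  have "superposition_within f (\<epsilon> / 4)"
    using assms(3,4) by (intro approximate_superposition) auto
  then obtain \<Phi> :: "nat \<Rightarrow> real \<Rightarrow> real" and \<phi> :: "'d \<Rightarrow> nat \<Rightarrow> real \<Rightarrow> real"
    where \<Phi>: "\<And>q. q < m \<Longrightarrow> continuous_on UNIV (\<Phi> q)"
      and \<phi>: "\<And>p q. q < m \<Longrightarrow> continuous_on {0..1} (\<phi> p q)"
      and approx: "\<And>x. x \<in> cbox 0 1 \<Longrightarrow> \<bar>f x - (\<Sum>q<m. \<Phi> q (\<Sum>p\<in>UNIV. \<phi> p q (x $ p)))\<bar> \<le> \<epsilon> / 4"
    unfolding superposition_within_def m_def[symmetric] by blast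
  \<comment> \<open>The error splits into \<epsilon> / 4 from the superposition and, over all
    \<open>m\<close> indices, \<epsilon> / 4 each for replacing the outer and the inner
    functions.\<close>
  define e where "e = \<epsilon> / (4 * real m)"
  have e: "0 < e"
    using assms(4) m by (simp add: e_def)
  have "\<exists>s\<in>kernel_span K. \<forall>x :: real^'d. x \<in> cbox 0 1 \<longrightarrow>
      \<bar>\<Phi> q (\<Sum>p\<in>UNIV. \<phi> p q (x $ p)) - s (\<Sum>p\<in>UNIV. \<phi> p q (x $ p))\<bar> < e" if q: "q < m" for q
  proof -
    \<comment> \<open>Density is applied on the compact range of the unperturbed inner sum.\<close>
    let ?T = "(\<lambda>x :: real^'d. \<Sum>p\<in>UNIV. \<phi> p q (x $ p)) ` cbox 0 1"
    have "compact ?T"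
      by (intro compact_continuous_image continuous_on_inner_sum \<phi> q compact_cbox)
    then obtain s where "s \<in> kernel_span K" "\<And>z. z \<in> ?T \<Longrightarrow> \<bar>\<Phi> q z - s z\<bar> < e"
      using kernel_span_dense[OF assms(1,2), of ?T "\<Phi> q" e] e continuous_on_subset[OF \<Phi>[OF q]] by blast
    then show ?thesis by blast
  qed
  then obtain \<Psi> where \<Psi>: "\<And>q. q < m \<Longrightarrow> \<Psi> q \<in> kernel_span K"
    and \<Psi>_near: "\<And>q x. q < m \<Longrightarrow> x \<in> cbox 0 (1 :: real^'d) \<Longrightarrow>
      \<bar>\<Phi> q (\<Sum>p\<in>UNIV. \<phi> p q (x $ p)) - \<Psi> q (\<Sum>p\<in>UNIV. \<phi> p q (x $ p))\<bar> < e"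
    by metis
  \<comment> \<open>\<delta> depends on the new outer functions, so the inner functions are replaced
    afterwards.\<close>
  obtain \<delta> where "0 < \<delta>" and \<delta>: "\<And>\<phi>' q x. (\<And>p t. t \<in> {0..1} \<Longrightarrow> \<bar>\<phi>' p t - \<phi> p q t\<bar> \<le> \<delta>) \<Longrightarrow>
      q < m \<Longrightarrow> x \<in> cbox 0 1 \<Longrightarrow>
      \<bar>\<Psi> q (\<Sum>p\<in>UNIV. \<phi>' p ((x :: real^'d) $ p)) - \<Psi> q (\<Sum>p\<in>UNIV. \<phi> p q (x $ p))\<bar> < e"
    by (rule inner_sum_perturbation[of m \<Psi> \<phi> e])
      (use continuous_on_kernel_span[OF assms(1) \<Psi>] \<phi> e in blast)+
  have "\<exists>s\<in>kernel_span K. \<forall>t\<in>{0..1}. \<bar>s t - \<phi> p q t\<bar> \<le> \<delta>" if q: "q < m" for p q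
    using kernel_span_dense[OF assms(1,2) compact_Icc \<phi>[OF q] \<open>0 < \<delta>\<close>]
    by (metis abs_minus_commute less_imp_le)
  then have "\<exists>\<psi>. \<forall>p q. q < m \<longrightarrow> \<psi> p q \<in> kernel_span K \<and> (\<forall>t\<in>{0..1}. \<bar>\<psi> p q t - \<phi> p q t\<bar> \<le> \<delta>)"
    by (intro choice allI) blast
  then obtain \<psi> where \<psi>: "\<And>p q. q < m \<Longrightarrow> \<psi> p q \<in> kernel_span K"
    and \<psi>_near: "\<And>p q t. q < m \<Longrightarrow> t \<in> {0..1} \<Longrightarrow> \<bar>\<psi> p q t - \<phi> p q t\<bar> \<le> \<delta>"
    by blast
  \<comment> \<open>The bound stays away from \<epsilon> because a supremum inherits only the
    non-strict inequality.\<close>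
  have "\<bar>f x - (\<Sum>q<m. \<Psi> q (\<Sum>p\<in>UNIV. \<psi> p q (x $ p)))\<bar> \<le> 3 / 4 * \<epsilon>" if x: "x \<in> cbox 0 1" for x
  proof -
    let ?z = "\<lambda>q. \<Sum>p\<in>UNIV. \<phi> p q (x $ p)" and ?z' = "\<lambda>q. \<Sum>p\<in>UNIV. \<psi> p q (x $ p)"
    have "\<bar>\<Phi> q (?z q) - \<Psi> q (?z' q)\<bar> \<le> 2 * e" if q: "q < m" for q
      using \<Psi>_near[OF q x] \<delta>[OF \<psi>_near[OF q] q x] by fastforce
    then have "(\<Sum>q<m. \<bar>\<Phi> q (?z q) - \<Psi> q (?z' q)\<bar>) \<le> (\<Sum>q<m. 2 * e)"
      by (intro sum_mono) auto
    then have "\<bar>\<Sum>q<m. \<Phi> q (?z q) - \<Psi> q (?z' q)\<bar> \<le> real m * (2 * e)"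
      by (intro order_trans[OF sum_abs]) simp
    moreover have "real m * (2 * e) = \<epsilon> / 2"
      using m by (simp add: e_def)
    moreover have "f x - (\<Sum>q<m. \<Psi> q (?z' q)) = (f x - (\<Sum>q<m. \<Phi> q (?z q))) + (\<Sum>q<m. \<Phi> q (?z q) - \<Psi> q (?z' q))"
      by (simp add: sum_subtractf)
    ultimately show ?thesis
      using approx[OF x] by linarith
  qed
  \<comment> \<open>Bounding the supremum requires a nonempty cube.\<close>
  moreover have "(0 :: real^'d) \<in> cbox 0 1"
    by (simp add: mem_box_cart)
  ultimately have "(SUP x\<in>cbox 0 1. \<bar>f x - (\<Sum>q<m. \<Psi> q (\<Sum>p\<in>UNIV. \<psi> p q (x $ p)))\<bar>) \<le> 3 / 4 * \<epsilon>"
    by (intro cSUP_least) auto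
  also have "\<dots> < \<epsilon>"
    using assms(4) by simp
  finally show ?thesis
    unfolding m_def[symmetric] using \<Psi> \<psi> by blast
qed

end
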